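(* Let $\delta_1,\delta_2,\delta_3\in[0,1]$ be independent of $\varepsilon$, and consider the BBMH system with relaxation parameter $\varepsilon>0$ in the split form $q_t=f(q)+g(q)$, $q=(u,v,w)^T$, with $$f(q)=-\begin{pmatrix}uu_x+\delta_1\varepsilon v_x\\ \frac{\delta_2}{\varepsilon}u_x\\ \delta_3\varepsilon^2w_x\end{pmatrix},\qquad g(q)=-\begin{pmatrix}(1-\delta_1\varepsilon)v_x\\ \frac{1-\delta_2\varepsilon}{\varepsilon^2}u_x-\frac1{\varepsilon^2}w\\ (1-\delta_3)\varepsilon^2w_x+v\end{pmatrix},$$ initialized with well-prepared initial data, i.e. $u(x,0)=\eta(x,0)$ and $w(x,0)=\eta_x(x,0)$, and with $v(x,0)=v_0(x;\varepsilon)$, where $v_0(x;\varepsilon)$ is a sufficiently smooth function. Then every globally stiffly accurate (GSA) IMEX Runge-Kutta method of type II (discrete in time with time step $\Delta t$, continuous in space) is asymptotic preserving with respect to $u$ and $w$, i.e., for the numerical solution $(u^n,v^n,w^n)$ after $n\ge1$ steps, $$u^n\to\eta^n,\qquad w^n\to\eta^n_x\qquad\text{for }\varepsilon\to0,$$ where $\eta^n$ is the numerical solution of the BBM equation $\eta_t+\eta\eta_x-\eta_{txx}=0$ obtained with the explicit part of the IMEX method. Furthermore, if the type II method has the ARS property, the $v$ component is asymptotic preserving as well, in the sense that $$v^n\to-D_t\eta^n_x\qquad\text{for }\varepsilon\to0,$$ where $D_t$ is the discrete time derivative operator induced by the method: $D_t\eta^{n+1}$ is the last component (the one belonging to stage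 $s$) of $$\hat A^{-1}\,\frac{\boldsymbol\eta-\eta^n\mathbf 1}{\Delta t},\qquad \boldsymbol\eta=(\eta^{(2)},\dots,\eta^{(s)})^T,\quad \mathbf 1=(1,\dots,1)^T\in\mathbb R^{s-1},$$ with $\eta^{(j)}$ the stages of the BBM scheme in the step from $t^n$ to $t^{n+1}$ (so that $\eta^{(s)}=\eta^{n+1}$ by the GSA property); $D_t\eta_x^{n+1}$ is given by the same formula with $\eta$ replaced by $\eta_x$.
   Context: Periodic boundary conditions in $x$ are used. The BBMH system is $u_t+uu_x+v_x=0$, $v_t+\varepsilon^{-2}u_x=\varepsilon^{-2}w$, $w_t+\varepsilon^2w_x=-v$, a hyperbolic approximation of the BBM equation, whose solution is denoted $\eta$. IMEX method: an $s$-stage diagonally implicit IMEX Runge-Kutta method is given by a strictly lower triangular matrix $\tilde A=(\tilde a_{ij})$ and weights $\tilde b$ (explicit part), and a lower triangular matrix $A=(a_{ij})$ and weights $b$ (implicit part). Applied to $q_t=f(q)+g(q)$ it reads $$q^{(i)}=q^n+\Delta t\sum_{j=1}^{i-1}\tilde a_{ij}f(q^{(j)})+\Delta t\sum_{j=1}^{i}a_{ij}g(q^{(j)}),\qquad q^{n+1}=q^n+\Delta t\sum_{i=1}^s\tilde b_if(q^{(i)})+\Delta t\sum_{i=1}^sb_ig(q^{(i)}).$$ It is of type II if $$A=\begin{pmatrix}0&0\\ \hat\alpha&\hat A\end{pmatrix},\qquad b^T=(\hat\beta,\hat b^T),$$ with $\hat\alpha\in\mathbb R^{s-1}$, $\hat\beta\in\mathbb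 R$ and $\hat A\in\mathbb R^{(s-1)\times(s-1)}$ invertible. A type II method has the ARS property if in addition $\hat\alpha=0$ and $\hat\beta=0$. The method is globally stiffly accurate (GSA) if $\tilde a_{si}=\tilde b_i$ and $a_{si}=b_i$ for all $i\in\{1,\dots,s\}$. BBM scheme: applying the explicit part to $(\mathrm I-\partial_x^2)\eta_t=-\eta\eta_x$ gives, with $\eta^0=\eta(\cdot,0)$, $$(\mathrm I-\partial_x^2)\frac{\eta^{(i)}-\eta^n}{\Delta t}=-\sum_{j=1}^{i-1}\tilde a_{ij}\,\eta^{(j)}\eta^{(j)}_x,\qquad(\mathrm I-\partial_x^2)\frac{\eta^{n+1}-\eta^n}{\Delta t}=-\sum_{i=1}^s\tilde b_i\,\eta^{(i)}\eta^{(i)}_x .$$ *)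

theory Defs
  imports "HOL-Analysis.Analysis" "Jordan_Normal_Form.Gauss_Jordan_Elimination"
begin

unbundle no vec_syntax

text \<open>
  Stages are indexed from 0, following the indexing of matrices and vectors: the mathematical
  stage \<open>i\<close> of an \<open>s\<close>-stage method has index \<open>i - 1\<close>, so the first stage is \<open>0\<close> and the last one
  is \<open>s - 1\<close>. In a tableau \<open>(At, bt, A, b)\<close>, \<open>At\<close> and \<open>bt\<close> are the matrix and weights of the
  explicit part and \<open>A\<close> and \<open>b\<close> those of the implicit part.
\<close>

definition dirk_imex_tableau ::
  "nat \<Rightarrow> real mat \<Rightarrow> real vec \<Rightarrow> real mat \<Rightarrow> real vec \<Rightarrow> bool" where
  "dirk_imex_tableau s At bt A b \<longleftrightarrow>
     At \<in> carrier_mat s s \<and> bt \<in> carrier_vec s \<and> A \<in> carrier_mat s s \<and> b \<in> carrier_vec s \<and>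
     (\<forall>i<s. \<forall>j<s. i \<le> j \<longrightarrow> At $$ (i, j) = 0) \<and>
     (\<forall>i<s. \<forall>j<s. i < j \<longrightarrow> A $$ (i, j) = 0)"

text \<open>The blocks \<open>\<alpha>h\<close>, \<open>\<beta>h\<close>, \<open>Ah\<close>, \<open>bh\<close> are those of \<open>A = (0, 0; \<alpha>h, Ah)\<close> and \<open>b = (\<beta>h, bh)\<close>.\<close>

definition type_II ::
  "nat \<Rightarrow> real mat \<Rightarrow> real vec \<Rightarrow> real vec \<Rightarrow> real mat \<Rightarrow> real \<Rightarrow> real vec \<Rightarrow> bool" where
  "type_II s A b \<alpha>h Ah \<beta>h bh \<longleftrightarrow>
     2 \<le> s \<and>
     \<alpha>h \<in> carrier_vec (s - 1) \<and> Ah \<in> carrier_mat (s - 1) (s - 1) \<and> bh \<in> carrier_vec (s - 1) \<and>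
     A = four_block_mat (0\<^sub>m 1 1) (0\<^sub>m 1 (s - 1)) (mat_of_cols (s - 1) [\<alpha>h]) Ah \<and>
     b = vec 1 (\<lambda>_. \<beta>h) @\<^sub>v bh \<and>
     invertible_mat Ah"

definition ARS_property :: "nat \<Rightarrow> real vec \<Rightarrow> real \<Rightarrow> bool" where
  "ARS_property s \<alpha>h \<beta>h \<longleftrightarrow> \<alpha>h = 0\<^sub>v (s - 1) \<and> \<beta>h = 0"

definition globally_stiffly_accurate ::
  "nat \<Rightarrow> real mat \<Rightarrow> real vec \<Rightarrow> real mat \<Rightarrow> real vec \<Rightarrow> bool" where
  "globally_stiffly_accurate s At bt A b \<longleftrightarrow>
     (\<forall>i<s. At $$ (s - 1, i) = bt $ i \<and> A $$ (s - 1, i) = b $ i)"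

text \<open>One step from \<open>q0\<close> to \<open>q1\<close> with stages \<open>Q 0, \<dots>, Q (s - 1)\<close> for \<open>q\<^sub>t = f q + g q\<close>, where
  the states are functions of the space variable.\<close>

definition imex_step ::
  "((real \<Rightarrow> 'v::real_vector) \<Rightarrow> real \<Rightarrow> 'v) \<Rightarrow> ((real \<Rightarrow> 'v) \<Rightarrow> real \<Rightarrow> 'v) \<Rightarrow>
   nat \<Rightarrow> real mat \<Rightarrow> real vec \<Rightarrow> real mat \<Rightarrow> real vec \<Rightarrow> real \<Rightarrow>
   (real \<Rightarrow> 'v) \<Rightarrow> (nat \<Rightarrow> real \<Rightarrow> 'v) \<Rightarrow> (real \<Rightarrow> 'v) \<Rightarrow> bool" where
  "imex_step f g s At bt A b dt q0 Q q1 \<longleftrightarrow>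
     (\<forall>i<s. \<forall>x. Q i x = q0 x + dt *\<^sub>R (\<Sum>j<i. At $$ (i, j) *\<^sub>R f (Q j) x)
                             + dt *\<^sub>R (\<Sum>j\<le>i. A $$ (i, j) *\<^sub>R g (Q j) x)) \<and>
     (\<forall>x. q1 x = q0 x + dt *\<^sub>R (\<Sum>i<s. bt $ i *\<^sub>R f (Q i) x)
                      + dt *\<^sub>R (\<Sum>i<s. b $ i *\<^sub>R g (Q i) x))"

definition periodic :: "real \<Rightarrow> (real \<Rightarrow> real) \<Rightarrow> bool" where
  "periodic L \<phi> \<longleftrightarrow> (\<forall>x. \<phi> (x + L) = \<phi> x)"

definition Ck_periodic :: "real \<Rightarrow> nat \<Rightarrow> (real \<Rightarrow> real) \<Rightarrow> bool" where
  "Ck_periodic L k \<phi> \<longleftrightarrow> periodic L \<phi> \<and>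
     (\<forall>j<k. \<forall>x. (deriv ^^ j) \<phi> field_differentiable at x) \<and>
     continuous_on UNIV ((deriv ^^ k) \<phi>)"

text \<open>Convergence in the \<open>C\<^sup>m\<close> norm as \<open>\<epsilon>\<close> tends to 0 from the right.\<close>

definition Cm_limit :: "real \<Rightarrow> nat \<Rightarrow> (real \<Rightarrow> real \<Rightarrow> real) \<Rightarrow> (real \<Rightarrow> real) \<Rightarrow> bool" where
  "Cm_limit L m F \<phi> \<longleftrightarrow>
     (\<forall>\<^sub>F \<epsilon> in at_right 0. Ck_periodic L m (F \<epsilon>)) \<and> Ck_periodic L m \<phi> \<and>
     (\<forall>j\<le>m. uniform_limit UNIV (\<lambda>\<epsilon>. (deriv ^^ j) (F \<epsilon>)) ((deriv ^^ j) \<phi>) (at_right 0))"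

text \<open>States of the BBMH system are maps \<open>x \<mapsto> (u x, v x, w x)\<close>.\<close>

type_synonym state = "real \<Rightarrow> real \<times> real \<times> real"

definition u_of :: "state \<Rightarrow> real \<Rightarrow> real" where "u_of q = (\<lambda>x. fst (q x))"
definition v_of :: "state \<Rightarrow> real \<Rightarrow> real" where "v_of q = (\<lambda>x. fst (snd (q x)))"
definition w_of :: "state \<Rightarrow> real \<Rightarrow> real" where "w_of q = (\<lambda>x. snd (snd (q x)))"

definition bbmh_f :: "real \<Rightarrow> real \<Rightarrow> real \<Rightarrow> real \<Rightarrow> state \<Rightarrow> state" where
  "bbmh_f \<delta>1 \<delta>2 \<delta>3 \<epsilon> q = (\<lambda>x. let u = u_of q; v = v_of q; w = w_of q in
     - (u x * deriv u x + \<delta>1 * \<epsilon> * deriv v x,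
        \<delta>2 / \<epsilon> * deriv u x,
        \<delta>3 * \<epsilon>\<^sup>2 * deriv w x))"

definition bbmh_g :: "real \<Rightarrow> real \<Rightarrow> real \<Rightarrow> real \<Rightarrow> state \<Rightarrow> state" where
  "bbmh_g \<delta>1 \<delta>2 \<delta>3 \<epsilon> q = (\<lambda>x. let u = u_of q; v = v_of q; w = w_of q in
     - ((1 - \<delta>1 * \<epsilon>) * deriv v x,
        (1 - \<delta>2 * \<epsilon>) / \<epsilon>\<^sup>2 * deriv u x - 1 / \<epsilon>\<^sup>2 * w x,
        (1 - \<delta>3) * \<epsilon>\<^sup>2 * deriv w x + v x))"

text \<open>
  \<open>q 0, \<dots>, q N\<close> is the numerical solution of the BBMH system for the relaxation parameter \<open>\<epsilon>\<close>;
  the stages are required to be classical (\<open>C\<^sup>1\<close>, periodic) solutions of the stage equations.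
\<close>

definition bbmh_numerical_solution ::
  "real \<Rightarrow> real \<Rightarrow> real \<Rightarrow> real \<Rightarrow> nat \<Rightarrow> real mat \<Rightarrow> real vec \<Rightarrow> real mat \<Rightarrow> real vec \<Rightarrow> real \<Rightarrow>
   real \<Rightarrow> nat \<Rightarrow> (nat \<Rightarrow> state) \<Rightarrow> bool" where
  "bbmh_numerical_solution \<delta>1 \<delta>2 \<delta>3 L s At bt A b dt \<epsilon> N q \<longleftrightarrow>
     (\<forall>n<N. \<exists>Q.
        (\<forall>i<s. Ck_periodic L 1 (u_of (Q i)) \<and> Ck_periodic L 1 (v_of (Q i)) \<and>
               Ck_periodic L 1 (w_of (Q i))) \<and>
        imex_step (bbmh_f \<delta>1 \<delta>2 \<delta>3 \<epsilon>) (bbmh_g \<delta>1 \<delta>2 \<delta>3 \<epsilon>) s At bt A b dt (q n) Q (q (Suc n)))"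

definition id_minus_dxx :: "(real \<Rightarrow> real) \<Rightarrow> real \<Rightarrow> real" where
  "id_minus_dxx \<phi> = (\<lambda>x. \<phi> x - deriv (deriv \<phi>) x)"

text \<open>
  \<open>\<eta> 0, \<dots>, \<eta> N\<close> is the numerical solution of the BBM equation by the explicit method \<open>(At, bt)\<close>,
  and \<open>E n i\<close> is the stage with index \<open>i\<close> in the step from \<open>\<eta> n\<close> to \<open>\<eta> (n + 1)\<close>.
\<close>

definition bbm_numerical_solution ::
  "real \<Rightarrow> nat \<Rightarrow> real mat \<Rightarrow> real vec \<Rightarrow> real \<Rightarrow>
   nat \<Rightarrow> (nat \<Rightarrow> real \<Rightarrow> real) \<Rightarrow> (nat \<Rightarrow> nat \<Rightarrow> real \<Rightarrow> real) \<Rightarrow> bool" where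
  "bbm_numerical_solution L s At bt dt N \<eta> E \<longleftrightarrow>
     (\<forall>n\<le>N. Ck_periodic L 2 (\<eta> n)) \<and>
     (\<forall>n<N.
        (\<forall>i<s. Ck_periodic L 2 (E n i)) \<and>
        (\<forall>i<s. \<forall>x. id_minus_dxx (\<lambda>y. (E n i y - \<eta> n y) / dt) x =
                     - (\<Sum>j<i. At $$ (i, j) * (E n j x * deriv (E n j) x))) \<and>
        (\<forall>x. id_minus_dxx (\<lambda>y. (\<eta> (Suc n) y - \<eta> n y) / dt) x =
               - (\<Sum>i<s. bt $ i * (E n i x * deriv (E n i) x))))"

text \<open>
  The discrete time derivative belonging to the step that starts from \<open>e0\<close> and has the stages \<open>e\<close>:
  the last component of \<open>Ah\<^sup>-\<^sup>1 ((e 1, \<dots>, e (s - 1)) - e0 1) / dt\<close>. For invertible \<open>Ah\<close>,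
  \<open>mat_inverse Ah\<close> is \<open>Some\<close> of the inverse matrix.
\<close>

definition discrete_dt ::
  "nat \<Rightarrow> real mat \<Rightarrow> real \<Rightarrow> (real \<Rightarrow> real) \<Rightarrow> (nat \<Rightarrow> real \<Rightarrow> real) \<Rightarrow> real \<Rightarrow> real" where
  "discrete_dt s Ah dt e0 e = (\<lambda>x.
     (the (mat_inverse Ah) *\<^sub>v vec (s - 1) (\<lambda>i. (e (Suc i) x - e0 x) / dt)) $ (s - 2))"

end

theory Submission
  imports Defs "Jordan_Normal_Form.Determinant"
begin

(*
  All estimates are in sup norms and rest on the maximum principle. Eliminating U_i and W_i from an
  implicit stage gives an elliptic equation for V_i, which bounds the stages uniformly in epsilon
  with a fixed loss of derivatives; the equation for v then shows w = u_x + O(epsilon) at every stage.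
  Subtracting the x-derivative of the equation for w from the one for u removes the implicit terms,
  so that (I - d_xx)(U_i - E_i) = O(epsilon), and the maximum principle for I - d_xx gives
  U_i - E_i = O(epsilon). By the GSA property the last stage is the new step. With the ARS property
  the equation for w reads dt * Ah V = -(W - w^n 1) + O(epsilon^2), which determines the limit of v.
*)

section \<open>Periodic functions and the maximum principle\<close>

text \<open>The diagonal entries of \<open>A\<close> are only known to be nonzero, so \<tau> = dt *
  a_ii may be negative and an energy estimate would have no sign to rely on. After the elimination
  both V and V_xx carry the square of \<tau>, which is why sup norms are used. The price is a loss
  of derivatives at every stage. It is affordable because the numbers of stages and steps are fixed:
  the data are taken in C^K with K of size 6 * s * n. Between steps, v is only kept bounded. Its
  initial value may depend on \<epsilon> without converging, and a type II method may feed it into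
  all later stages. This does no harm to u and w: v^n enters the equation for v with the factor
  \<epsilon>^2, and V_x drops out of the comparison with the BBM stage up to a term of order
  \<epsilon>. In stage 0, where a_00 = 0, the equation for v says nothing about w - u_x, so its
  smallness must come from the state at the start of the step: from the well-prepared data in the
  first step, and from the closeness to \<eta> and \<eta>_x afterwards.\<close>

lemma Ck_0: "Ck_periodic L 0 f \<longleftrightarrow> periodic L f \<and> continuous_on UNIV f"
  by (simp add: Ck_periodic_def)

lemma periodic_deriv:
  assumes "periodic L f" shows "periodic L (deriv f)"
proof -
  have eq: "f = (\<lambda>x. f (x + L))" using assms by (auto simp: periodic_def)
  have "(f has_field_derivative D) (at (x + L)) = (f has_field_derivative D) (at x)" for x D
    by (subst DERIV_shift, subst eq[symmetric], rule refl)
  then show ?thesis by (simp add: periodic_def deriv_def)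
qed

lemma Ck_Suc:
  "Ck_periodic L (Suc k) f \<longleftrightarrow>
     periodic L f \<and> (\<forall>x. f field_differentiable at x) \<and> Ck_periodic L k (deriv f)"
proof -
  have "(\<forall>j<Suc k. P j) \<longleftrightarrow> P 0 \<and> (\<forall>j<k. P (Suc j))" for P
    by (auto simp: less_Suc_eq_0_disj)
  then show ?thesis by (auto simp: Ck_periodic_def periodic_deriv funpow_swap1)
qed

text \<open>One constant serves all derivatives up to order \<open>k\<close>. Membership then
  unfolds along \<open>deriv\<close> (\<open>Ck_bounded_Suc\<close>), which turns the estimates into
  inductions on \<open>k\<close>.\<close>

definition Ck_bounded :: "real \<Rightarrow> nat \<Rightarrow> real \<Rightarrow> (real \<Rightarrow> real) \<Rightarrow> bool" where
  "Ck_bounded L k c f \<longleftrightarrow> Ck_periodic L k f \<and> (\<forall>j\<le>k. \<forall>x. \<bar>(deriv ^^ j) f x\<bar> \<le> c)"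

lemma Ck_bounded_0: "Ck_bounded L 0 c f \<longleftrightarrow> periodic L f \<and> continuous_on UNIV f \<and> (\<forall>x. \<bar>f x\<bar> \<le> c)"
  by (simp add: Ck_bounded_def Ck_0)

lemma Ck_bounded_Suc:
  "Ck_bounded L (Suc k) c f \<longleftrightarrow> periodic L f \<and> (\<forall>x. \<bar>f x\<bar> \<le> c) \<and>
     (\<forall>x. f field_differentiable at x) \<and> Ck_bounded L k c (deriv f)"
proof -
  have "(\<forall>j\<le>Suc k. P j) \<longleftrightarrow> P 0 \<and> (\<forall>j\<le>k. P (Suc j))" for P
    by (metis Suc_le_mono le0 not0_implies_Suc)
  then show ?thesis by (auto simp: Ck_bounded_def Ck_Suc funpow_swap1)
qed

lemma Ck_bounded_nonneg: "Ck_bounded L k c f \<Longrightarrow> 0 \<le> c"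
  by (cases k) (auto simp: Ck_bounded_0 Ck_bounded_Suc intro: order_trans[OF abs_ge_zero])

lemma Ck_bounded_imp_Ck: "Ck_bounded L k c f \<Longrightarrow> Ck_periodic L k f"
  by (simp add: Ck_bounded_def)

lemma Ck_bounded_mono: "Ck_bounded L k c f \<Longrightarrow> c \<le> d \<Longrightarrow> Ck_bounded L k d f"
  unfolding Ck_bounded_def using order_trans by blast

lemma Ck_le: "Ck_periodic L k f \<Longrightarrow> j \<le> k \<Longrightarrow> Ck_periodic L j f"
proof (induction k)
  case (Suc k)
  have "continuous_on UNIV ((deriv ^^ k) f)"
    using Suc.prems
    by (auto simp: Ck_periodic_def field_differentiable_imp_continuous_at continuous_at_imp_continuous_on)
  then show ?case using Suc by (auto simp: Ck_periodic_def le_Suc_eq)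
qed simp

lemma Ck_bounded_le: "Ck_bounded L k c f \<Longrightarrow> j \<le> k \<Longrightarrow> Ck_bounded L j c f"
  using Ck_le by (auto simp: Ck_bounded_def)

lemma periodic_combine: "periodic L f \<Longrightarrow> periodic L g \<Longrightarrow> periodic L (\<lambda>x. h (f x) (g x))"
  by (simp add: periodic_def)

lemma Ck_bounded_add:
  "Ck_bounded L k c f \<Longrightarrow> Ck_bounded L k d g \<Longrightarrow> Ck_bounded L k (c + d) (\<lambda>x. f x + g x)"
proof (induction k arbitrary: f g)
  case 0
  then show ?case by (auto simp: Ck_bounded_0 periodic_combine intro!: continuous_intros
      intro: order_trans[OF abs_triangle_ineq] add_mono)
next
  case (Suc k)
  then have "deriv (\<lambda>x. f x + g x) = (\<lambda>x. deriv f x + deriv g x)"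
    by (auto simp: Ck_bounded_Suc)
  with Suc show ?case by (auto simp: Ck_bounded_Suc periodic_combine field_differentiable_add
      intro!: order_trans[OF abs_triangle_ineq] add_mono)
qed

lemma Ck_bounded_cmult:
  "Ck_bounded L k c f \<Longrightarrow> Ck_bounded L k (\<bar>a\<bar> * c) (\<lambda>x. a * f x)"
proof (induction k arbitrary: f)
  case 0
  then show ?case by (auto simp: Ck_bounded_0 abs_mult mult_left_mono periodic_def intro!: continuous_intros)
next
  case (Suc k)
  then have "deriv (\<lambda>x. a * f x) = (\<lambda>x. a * deriv f x)"
    by (auto simp: Ck_bounded_Suc)
  with Suc show ?case
    by (auto simp: Ck_bounded_Suc periodic_def abs_mult mult_left_mono intro!: derivative_intros)
qed

text \<open>The factor \<open>2 ^ k\<close> counts the products in the Leibniz rule: each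
  differentiation doubles their number.\<close>

lemma Ck_bounded_mult:
  "Ck_bounded L k c f \<Longrightarrow> Ck_bounded L k d g \<Longrightarrow> Ck_bounded L k (2 ^ k * c * d) (\<lambda>x. f x * g x)"
proof (induction k arbitrary: f g)
  case 0
  then show ?case
    using Ck_bounded_nonneg[of L 0 c f]
    by (auto simp: Ck_bounded_0 periodic_combine abs_mult mult_mono intro!: continuous_intros)
next
  case (Suc k)
  have nn: "0 \<le> c" "0 \<le> d" using Suc.prems Ck_bounded_nonneg by blast+
  have "deriv (\<lambda>x. f x * g x) = (\<lambda>x. f x * deriv g x + deriv f x * g x)"
    using Suc.prems by (auto simp: Ck_bounded_Suc)
  moreover have "Ck_bounded L k (2 ^ k * c * d + 2 ^ k * c * d) (\<lambda>x. f x * deriv g x + deriv f x * g x)"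
    using Suc.prems Ck_bounded_le[OF Suc.prems(1), of k] Ck_bounded_le[OF Suc.prems(2), of k]
    by (intro Ck_bounded_add Suc.IH) (auto simp: Ck_bounded_Suc)
  moreover have "\<bar>f x * g x\<bar> \<le> 2 ^ Suc k * c * d" for x
  proof -
    have "\<bar>f x * g x\<bar> \<le> c * d" using Suc.prems nn by (auto simp: Ck_bounded_Suc abs_mult mult_mono)
    also have "\<dots> \<le> 2 ^ Suc k * (c * d)"
      using nn mult_right_mono[of 1 "2 ^ Suc k :: real" "c * d"] one_le_power[of "2 :: real" "Suc k"]
      by simp
    finally show ?thesis by (simp add: mult.assoc)
  qed
  ultimately show ?case
    using Suc.prems by (auto simp: Ck_bounded_Suc periodic_combine field_differentiable_mult mult_ac)
qed

lemma periodic_int: "periodic L f \<Longrightarrow> f (x + of_int n * L) = f x"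
proof (induction n rule: int_induct[of _ 0])
  case (step1 i)
  have "f (x + of_int (i + 1) * L) = f ((x + of_int i * L) + L)" by (simp add: algebra_simps)
  with step1 show ?case by (simp add: periodic_def)
next
  case (step2 i)
  have "f (x + of_int (i - 1) * L) = f ((x + of_int (i - 1) * L) + L)"
    using step2 by (simp add: periodic_def)
  also have "\<dots> = f (x + of_int i * L)" by (simp add: algebra_simps)
  finally show ?case using step2 by simp
qed simp

lemma periodic_attains_max:
  assumes "L > 0" "periodic L f" "continuous_on UNIV f"
  obtains x0 where "\<And>x. f x \<le> (f x0 :: real)"
proof -
  obtain x0 where x0: "\<forall>y\<in>{0..L}. f y \<le> f x0"
    using continuous_attains_sup[of "{0..L}" f] assms continuous_on_subset[of UNIV f]
    by (metis atLeastAtMost_iff compact_Icc empty_iff less_eq_real_def order_refl subset_UNIV)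
  have "f x \<le> f x0" for x
  proof -
    define n where "n = \<lfloor>x / L\<rfloor>"
    have "of_int n \<le> x / L" "x / L < of_int n + 1" unfolding n_def by linarith+
    then have "x + of_int (- n) * L \<in> {0..L}"
      using assms(1) by (auto simp: field_simps)
    then show ?thesis using x0 periodic_int[OF assms(2), of x "-n"] by metis
  qed
  then show ?thesis using that by blast
qed

lemma periodic_attains_abs_max:
  assumes "L > 0" "periodic L f" "continuous_on UNIV f"
  obtains x0 where "\<And>x. \<bar>f x\<bar> \<le> \<bar>f x0 :: real\<bar>"
  using periodic_attains_max[of L "\<lambda>x. \<bar>f x\<bar>"] assms
  by (auto simp: periodic_def intro!: continuous_intros)

lemma Ck_imp_bounded: "L > 0 \<Longrightarrow> Ck_periodic L k f \<Longrightarrow> \<exists>c. Ck_bounded L k c f"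
proof (induction k arbitrary: f)
  case 0
  then show ?case using periodic_attains_abs_max[of L f] by (auto simp: Ck_0 Ck_bounded_0)
next
  case (Suc k)
  obtain c where c: "Ck_bounded L k c (deriv f)" using Suc by (auto simp: Ck_Suc)
  obtain d where d: "Ck_bounded L 0 d f"
    using Ck_le[OF Suc.prems(2), of 0] periodic_attains_abs_max[OF Suc.prems(1), of f]
    by (auto simp: Ck_0 Ck_bounded_0)
  have "Ck_bounded L (Suc k) (max c d) f"
    using c d Ck_bounded_mono[OF c, of "max c d"] Suc.prems
    by (auto simp: Ck_bounded_Suc Ck_Suc Ck_bounded_0 intro: max.coboundedI2)
  then show ?case ..
qed

text \<open>Compactness of one period makes boundedness automatic, so closure of C^k under sums and
  products is inherited from the quantitative lemmas.\<close>

lemma Ck_iff_bounded: "L > 0 \<Longrightarrow> Ck_periodic L k f \<longleftrightarrow> (\<exists>c. Ck_bounded L k c f)"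
  using Ck_imp_bounded Ck_bounded_imp_Ck by blast

lemma Ck_add: "L > 0 \<Longrightarrow> Ck_periodic L k f \<Longrightarrow> Ck_periodic L k g \<Longrightarrow> Ck_periodic L k (\<lambda>x. f x + g x)"
  by (auto simp: Ck_iff_bounded intro: Ck_bounded_add)

lemma Ck_cmult: "L > 0 \<Longrightarrow> Ck_periodic L k f \<Longrightarrow> Ck_periodic L k (\<lambda>x. a * f x)"
  using Ck_bounded_cmult[of L k _ f a] by (auto simp: Ck_iff_bounded)

lemma Ck_diff: "L > 0 \<Longrightarrow> Ck_periodic L k f \<Longrightarrow> Ck_periodic L k g \<Longrightarrow> Ck_periodic L k (\<lambda>x. f x - g x)"
  using Ck_add[of L k f "\<lambda>x. (-1) * g x"] Ck_cmult[of L k g "-1"] by simp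

lemma Ck_mult: "L > 0 \<Longrightarrow> Ck_periodic L k f \<Longrightarrow> Ck_periodic L k g \<Longrightarrow> Ck_periodic L k (\<lambda>x. f x * g x)"
  by (auto simp: Ck_iff_bounded intro: Ck_bounded_mult)

lemma Ck_bounded_zero: "Ck_bounded L k 0 (\<lambda>x. 0)"
  by (induction k) (auto simp: Ck_bounded_0 Ck_bounded_Suc periodic_def)

lemma Ck_sum:
  "L > 0 \<Longrightarrow> (\<And>i. i \<in> I \<Longrightarrow> Ck_periodic L k (f i)) \<Longrightarrow> Ck_periodic L k (\<lambda>x. \<Sum>i\<in>I. f i x)"
  by (induction I rule: infinite_finite_induct)
    (auto intro!: Ck_add Ck_bounded_imp_Ck[OF Ck_bounded_zero])

lemma Ck_deriv: "Ck_periodic L (Suc k) f \<Longrightarrow> Ck_periodic L k (deriv f)"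
  by (simp add: Ck_Suc)

lemma Ck_differentiable: "Ck_periodic L k f \<Longrightarrow> k \<noteq> 0 \<Longrightarrow> f field_differentiable at x"
  by (cases k) (auto simp: Ck_Suc)

lemma Ck_DERIV:
  "Ck_periodic L k f \<Longrightarrow> k \<noteq> 0 \<Longrightarrow> (f has_field_derivative deriv f x) (at x)"
  using Ck_differentiable field_differentiable_derivI by blast

lemma Ck2_DERIV:
  assumes "Ck_periodic L 2 f"
  shows "(f has_field_derivative deriv f x) (at x)"
    and "(deriv f has_field_derivative deriv (deriv f) x) (at x)"
  using assms by (auto intro!: field_differentiable_derivI simp: numeral_2_eq_2 Ck_Suc)

section \<open>Maximum principles and an interpolation inequality\<close>

lemma DERIV2_max_nonpos:
  fixes f :: "real \<Rightarrow> real"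
  assumes f': "\<And>x. (f has_field_derivative f' x) (at x)"
    and f'': "(f' has_field_derivative D) (at x0)" and max: "\<And>x. f x \<le> f x0"
  shows "D \<le> 0"
proof (rule ccontr)
  assume "\<not> D \<le> 0"
  have "f' x0 = 0" using DERIV_local_max[OF f'[of x0], of 1] max by simp
  with \<open>\<not> D \<le> 0\<close> f'' obtain d where d: "d > 0" "\<And>h. 0 < h \<Longrightarrow> h < d \<Longrightarrow> 0 < f' (x0 + h)"
    using DERIV_pos_inc_right[of f' D x0] by (metis not_le)
  \<comment> \<open>\<open>f'\<close> vanishes at \<open>x0\<close> and would be positive just to
    the right of it, so \<open>f\<close> would exceed its maximum.\<close>
  have "f x0 < f (x0 + d / 2)"
  proof (rule DERIV_pos_imp_increasing_open[where f = f])
    show "\<exists>y. (f has_field_derivative y) (at x) \<and> 0 < y" if "x0 < x" "x < x0 + d / 2" for x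
      using f'[of x] d(2)[of "x - x0"] that by auto
    show "continuous_on {x0..x0 + d / 2} f"
      using f' by (meson DERIV_continuous continuous_at_imp_continuous_on)
  qed (use d in simp)
  with max[of "x0 + d / 2"] show False by simp
qed

text \<open>At a maximum of \<open>f\<close> the second derivative is nonpositive, so
  \<open>c * f\<close> is at most the left side of \<open>g\<close> there.\<close>

lemma helmholtz_one_sided:
  assumes L: "L > 0" and f: "Ck_periodic L 2 f" and "a \<ge> 0"
    and g: "\<And>x. c * f x - a * deriv (deriv f) x \<le> M" and c: "c > 0"
  shows "c * f x \<le> M"
proof -
  obtain x0 where x0: "\<And>x. f x \<le> f x0"
    using periodic_attains_max[OF L] Ck_le[OF f, of 0] by (auto simp: Ck_0)
  have "deriv (deriv f) x0 \<le> 0"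
    using f x0 by (intro DERIV2_max_nonpos[of f "deriv f" _ x0])
      (auto intro!: field_differentiable_derivI simp: numeral_2_eq_2 Ck_Suc)
  then have "a * deriv (deriv f) x0 \<le> 0"
    using \<open>a \<ge> 0\<close> by (simp add: mult_nonneg_nonpos)
  then have "c * f x0 \<le> M" using g[of x0] by simp
  moreover have "c * f x \<le> c * f x0" using x0 c by simp
  ultimately show ?thesis by simp
qed

lemma helmholtz_sup_bound:
  assumes L: "L > 0" and f: "Ck_periodic L 2 f" and a: "a \<ge> 0" and c: "c > 0"
    and g: "\<And>x. \<bar>c * f x - a * deriv (deriv f) x\<bar> \<le> M"
  shows "c * \<bar>f x\<bar> \<le> M"
proof -
  have d: "deriv (\<lambda>x. - f x) = (\<lambda>x. - deriv f x)"
    using Ck_differentiable[OF f] by (auto intro!: deriv_minus)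
  have dd: "deriv (deriv (\<lambda>x. - f x)) = (\<lambda>x. - deriv (deriv f) x)"
    using Ck_differentiable[of L 1 "deriv f"] f
    unfolding d by (auto intro!: deriv_minus Ck_deriv simp: numeral_2_eq_2)
  have 1: "c * f x \<le> M" using helmholtz_one_sided[OF L f a _ c] g by (auto simp: abs_le_iff)
  have 2: "c * (- f x) \<le> M"
  proof (rule helmholtz_one_sided[where f = "\<lambda>x. - f x", OF L _ a _ c])
    show "Ck_periodic L 2 (\<lambda>x. - f x)" using Ck_cmult[OF L f, of "-1"] by simp
    show "c * - f x - a * deriv (deriv (\<lambda>x. - f x)) x \<le> M" for x
      unfolding dd using abs_le_D2[OF g[of x]] by (simp add: algebra_simps)
  qed
  from 1 2 show ?thesis by (auto simp: abs_if)
qed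

text \<open>At both extrema the derivative vanishes and the expression reduces to \<open>f\<close>.
  Hence \<open>a\<close> may have either sign, as it does in the equation for w, where it is \<tau>
  * c3 * \<epsilon>^2.\<close>

lemma transport_sup_bound:
  assumes L: "L > 0" and f: "Ck_periodic L 1 f"
    and g: "\<And>x. \<bar>f x + a * deriv f x\<bar> \<le> M"
  shows "\<bar>f x\<bar> \<le> M"
proof -
  have per: "periodic L f" "continuous_on UNIV f" using Ck_le[OF f, of 0] by (auto simp: Ck_0)
  have D: "(f has_field_derivative deriv f x) (at x)" for x using Ck_DERIV[OF f] by simp
  obtain x1 where x1: "\<And>x. f x \<le> f x1" using periodic_attains_max[OF L per] by auto
  obtain x2 where x2: "\<And>x. - f x \<le> - f x2"
    using periodic_attains_max[of L "\<lambda>x. - f x"] L per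
    by (auto simp: periodic_def intro!: continuous_intros)
  have "deriv f x1 = 0" using DERIV_local_max[OF D[of x1], of 1] x1 by simp
  moreover have "deriv f x2 = 0" using DERIV_local_min[OF D[of x2], of 1] x2 by simp
  ultimately show ?thesis using g[of x1] g[of x2] x1[of x] x2[of x] by simp
qed

text \<open>Interpolation on an interval of length 1: by the mean value theorem the derivative is at
  most \<open>2 * X\<close> in absolute value somewhere on it, and it changes by at most
  \<open>Y\<close> from there to \<open>x\<close>.\<close>

lemma landau_bound:
  fixes f :: "real \<Rightarrow> real"
  assumes f: "Ck_periodic L 2 f" and X: "\<And>x. \<bar>f x\<bar> \<le> X" and Y: "\<And>x. \<bar>deriv (deriv f) x\<bar> \<le> Y"
  shows "\<bar>deriv f x\<bar> \<le> 2 * X + Y"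
proof -
  have D: "(f has_field_derivative deriv f x) (at x)" for x using Ck_DERIV[OF f] by simp
  have D2: "(deriv f has_field_derivative deriv (deriv f) x) (at x)" for x
    using Ck_DERIV[of L 1] f by (simp add: Ck_deriv numeral_2_eq_2)
  obtain y where y: "x < y" "y < x + 1" "f (x + 1) - f x = deriv f y"
    using MVT2[of x "x + 1" f "deriv f"] D by auto
  obtain z where z: "deriv f y - deriv f x = (y - x) * deriv (deriv f) z"
    using MVT2[of x y "deriv f" "deriv (deriv f)"] D2 y(1) by auto
  have "\<bar>deriv f y - deriv f x\<bar> \<le> 1 * Y"
    unfolding z abs_mult using y Y[of z] by (intro mult_mono) auto
  then show ?thesis using y(3) X[of "x + 1"] X[of x] by linarith
qed

text \<open>I - d_xx commutes with d_x, so the sup bound applies to each derivative with the same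
  constant.\<close>

lemma Ck_bounded_helmholtz:
  "L > 0 \<Longrightarrow> Ck_periodic L (k + 2) f \<Longrightarrow> Ck_bounded L k c (\<lambda>x. f x - deriv (deriv f) x) \<Longrightarrow>
   Ck_bounded L k c f"
proof (induction k arbitrary: f)
  case 0
  then have "\<bar>f x\<bar> \<le> c" for x
    using helmholtz_sup_bound[of L f 1 1 c] by (auto simp: Ck_bounded_0 numeral_2_eq_2)
  then show ?case using Ck_le[OF 0(2), of 0] by (auto simp: Ck_bounded_0 Ck_0)
next
  case (Suc k)
  have b: "\<bar>f x\<bar> \<le> c" for x
    using helmholtz_sup_bound[of L f 1 1 c] Suc.prems Ck_le[OF Suc.prems(2), of 2]
    by (auto simp: Ck_bounded_Suc)
  have d: "Ck_periodic L (k + 2) (deriv f)" "Ck_periodic L (k + 1) (deriv (deriv f))"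
    using Suc.prems(2) by (auto simp: Ck_Suc)
  have "deriv (\<lambda>x. f x - deriv (deriv f) x) = (\<lambda>x. deriv f x - deriv (deriv (deriv f)) x)"
    using Ck_differentiable[OF Suc.prems(2)] Ck_differentiable[OF d(2)] by auto
  then have "Ck_bounded L k c (\<lambda>x. deriv f x - deriv (deriv (deriv f)) x)"
    using Suc.prems(3) by (auto simp: Ck_bounded_Suc)
  then have "Ck_bounded L k c (deriv f)" using Suc.IH d(1) Suc.prems(1) by blast
  then show ?case using b Suc.prems(2) by (auto simp: Ck_bounded_Suc Ck_Suc)
qed

text \<open>Bootstrapping: \<open>deriv (deriv f)\<close> is \<open>f\<close> minus the given
  function, so it is as smooth as the less smooth of the two.\<close>

lemma Ck_helmholtz_regularity:
  assumes L: "L > 0" and f: "Ck_periodic L 2 f"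
  shows "Ck_periodic L k (\<lambda>x. f x - deriv (deriv f) x) \<Longrightarrow> Ck_periodic L (k + 2) f"
proof (induction k)
  case 0
  then show ?case using f by (simp add: numeral_2_eq_2)
next
  case (Suc k)
  have "Ck_periodic L (k + 2) f" using Suc Ck_le by (meson le_SucI order_refl)
  then have "Ck_periodic L (Suc k) (\<lambda>x. f x - (f x - deriv (deriv f) x))"
    by (intro Ck_diff L Suc.prems) (auto intro: Ck_le)
  then show ?case using f by (auto simp: Ck_Suc numeral_2_eq_2)
qed

section \<open>Uniform bounds for an implicit stage\<close>

text \<open>An implicit stage with \<tau> = dt * a_ii; the right-hand sides collect the old state
  and the earlier stages. The equation for v is multiplied by \<epsilon>^2, so that no coefficient
  is singular as \<epsilon> tends to 0.\<close>

definition stage_system where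
  "stage_system \<tau> c1 c2 c3 \<epsilon> U V W Ru Sv Rw \<longleftrightarrow> (\<forall>x::real.
     U x + \<tau> * c1 * deriv V x = Ru x \<and>
     \<epsilon>\<^sup>2 * V x + \<tau> * (c2 * deriv U x - W x) = Sv x \<and>
     W x + \<tau> * (c3 * \<epsilon>\<^sup>2 * deriv W x + V x) = (Rw x :: real))"

text \<open>The lower bounds 1/2 keep the elimination uniformly elliptic. The last condition lets
  the feedback of \<open>deriv V\<close> through \<open>deriv W\<close> be absorbed; 20 is twice the
  factor 2 + 8 that results from \<open>landau_bound\<close>.\<close>

definition admissible_coeffs :: "real \<Rightarrow> real \<Rightarrow> real \<Rightarrow> real \<Rightarrow> real \<Rightarrow> bool" where
  "admissible_coeffs \<tau> c1 c2 c3 \<epsilon> \<longleftrightarrow> \<tau> \<noteq> 0 \<and> c1 \<in> {1/2..1} \<and> c2 \<in> {1/2..1} \<and> c3 \<in> {0..1} \<and>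
     \<epsilon> \<in> {0<..1} \<and> 20 * \<epsilon>\<^sup>2 * \<bar>\<tau>\<bar> \<le> 1"

lemma Ck_rescale:
  assumes "L > 0" "Ck_periodic L k (\<lambda>x. a * f x)" "a \<noteq> 0"
  shows "Ck_periodic L k f"
  using Ck_cmult[OF assms(1,2), of "1 / a"] assms(3) by simp

text \<open>Each equation can be solved for one first derivative, which gains one order per round.
  This concerns a single \<epsilon> and gives no uniform bound; it justifies the differentiations in
  the estimates.\<close>

lemma stage_regularity:
  assumes L: "L > 0" and adm: "admissible_coeffs \<tau> c1 c2 c3 \<epsilon>"
    and sys: "stage_system \<tau> c1 c2 c3 \<epsilon> U V W Ru Sv Rw"
    and C1: "Ck_periodic L 1 U" "Ck_periodic L 1 V" "Ck_periodic L 1 W"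
  shows "Ck_periodic L (Suc k) Ru \<Longrightarrow> Ck_periodic L (Suc k) Sv \<Longrightarrow> Ck_periodic L (Suc k) Rw \<Longrightarrow>
    Ck_periodic L (Suc k) U \<and> Ck_periodic L (Suc k) V \<and> Ck_periodic L (Suc k) W"
proof (induction k)
  case 0
  then show ?case using C1 by simp
next
  case (Suc k)
  then have R: "Ck_periodic L (Suc k) Ru" "Ck_periodic L (Suc k) Sv" "Ck_periodic L (Suc k) Rw"
    by (auto intro: Ck_le)
  have IH: "Ck_periodic L (Suc k) U" "Ck_periodic L (Suc k) V" "Ck_periodic L (Suc k) W"
    using Suc.IH R by auto
  have nz: "\<tau> \<noteq> 0" "c1 \<noteq> 0" "c2 \<noteq> 0" "\<epsilon> \<noteq> 0" using adm by (auto simp: admissible_coeffs_def)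
  have raise: "Ck_periodic L (Suc (Suc k)) f"
    if "Ck_periodic L 1 f" "Ck_periodic L (Suc k) (\<lambda>x. a * deriv f x)" "a \<noteq> 0" for f a
    using that Ck_rescale[OF L that(2,3)] by (simp add: Ck_Suc)
  have "(\<lambda>x. (\<tau> * c1) * deriv V x) = (\<lambda>x. Ru x - U x)"
    using sys by (auto simp: stage_system_def algebra_simps)
  then have V: "Ck_periodic L (Suc (Suc k)) V"
    using nz R IH by (intro raise[of V "\<tau> * c1"] C1) (auto intro!: Ck_diff L)
  have "(\<tau> * c2) * deriv U x = Sv x - (\<epsilon>\<^sup>2 * V x - \<tau> * W x)" for x
    using sys[unfolded stage_system_def, rule_format, of x] by (simp add: algebra_simps)
  then have U: "Ck_periodic L (Suc (Suc k)) U"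
    using nz R IH by (intro raise[of U "\<tau> * c2"] C1) (auto intro!: Ck_diff Ck_cmult L)
  have W: "Ck_periodic L (Suc (Suc k)) W"
  \<comment> \<open>For \<open>c3 = 0\<close> the third equation is algebraic in \<open>W\<close>,
    whose regularity then comes from that of \<open>V\<close> just obtained.\<close>
  proof (cases "c3 = 0")
    case True
    then have "W x = Rw x - \<tau> * V x" for x
      using sys[unfolded stage_system_def, rule_format, of x] by (simp add: algebra_simps)
    then have "W = (\<lambda>x. Rw x - \<tau> * V x)" by auto
    then show ?thesis using Suc.prems V by (auto intro!: Ck_diff Ck_cmult L)
  next
    case False
    have "(\<tau> * (c3 * \<epsilon>\<^sup>2)) * deriv W x = Rw x - (W x + \<tau> * V x)" for x
      using sys[unfolded stage_system_def, rule_format, of x] by (simp add: algebra_simps)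
    then show ?thesis
      using nz R IH False
      by (intro raise[of W "\<tau> * (c3 * \<epsilon>\<^sup>2)"] C1) (auto intro!: Ck_diff Ck_add Ck_cmult L)
  qed
  from U V W show ?case by blast
qed

text \<open>The coefficients do not depend on x. Hence a sup bound for solutions of the system is
  also one for all their derivatives.\<close>

lemma stage_system_deriv:
  assumes sys: "stage_system \<tau> c1 c2 c3 \<epsilon> U V W Ru Sv Rw"
    and C: "Ck_periodic L 2 U" "Ck_periodic L 2 V" "Ck_periodic L 2 W"
  shows "stage_system \<tau> c1 c2 c3 \<epsilon> (deriv U) (deriv V) (deriv W) (deriv Ru) (deriv Sv) (deriv Rw)"
proof -
  have R: "Ru = (\<lambda>x. U x + \<tau> * c1 * deriv V x)"
    "Sv = (\<lambda>x. \<epsilon>\<^sup>2 * V x + \<tau> * (c2 * deriv U x - W x))"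
    "Rw = (\<lambda>x. W x + \<tau> * (c3 * \<epsilon>\<^sup>2 * deriv W x + V x))"
    using sys by (auto simp: stage_system_def)
  note D = Ck2_DERIV[where L = L]
  show ?thesis
    unfolding stage_system_def R
    by (intro allI conjI DERIV_imp_deriv[symmetric])
      (auto intro!: derivative_eq_intros D C simp: algebra_simps)
qed

text \<open>With \<open>B\<close> the bound for \<open>V\<close> and \<open>deriv V\<close> found
  below, \<open>stage_const \<tau> * M\<close> is \<open>M + B + \<bar>\<tau>\<bar> * B\<close>.
  This dominates \<open>B\<close> as well as the bound \<open>M + \<bar>\<tau>\<bar> * B\<close> for
  \<open>U\<close> and \<open>W\<close>.\<close>

definition stage_const :: "real \<Rightarrow> real" where
  "stage_const \<tau> = 1 + (1 + \<bar>\<tau>\<bar>) * (20 * (1 + 2 * \<bar>\<tau>\<bar>) / \<tau>\<^sup>2 + 20)"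

text \<open>Eliminating \<open>U\<close> and \<open>W\<close> from the stage system leaves an elliptic equation for \<open>V\<close> whose
  right-hand side contains \<open>deriv W\<close> only with the factor \<open>\<epsilon>\<^sup>2\<close>. The maximum principle bounds \<open>V\<close>
  by this right-hand side, and \<open>deriv W\<close> by \<open>deriv V\<close>, so that the term is absorbed for
  small \<open>\<epsilon>\<close>, whatever the sign of \<open>\<tau>\<close>.\<close>

lemma stage_sup_bound:
  assumes L: "L > 0" and adm: "admissible_coeffs \<tau> c1 c2 c3 \<epsilon>"
    and sys: "stage_system \<tau> c1 c2 c3 \<epsilon> U V W Ru Sv Rw"
    and C: "Ck_periodic L 2 U" "Ck_periodic L 2 V" "Ck_periodic L 2 W"
    and M: "\<And>x. \<bar>Ru x\<bar> \<le> M" "\<And>x. \<bar>deriv Ru x\<bar> \<le> M" "\<And>x. \<bar>Sv x\<bar> \<le> M"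
      "\<And>x. \<bar>Rw x\<bar> \<le> M" "\<And>x. \<bar>deriv Rw x\<bar> \<le> M"
  shows "\<bar>U x\<bar> \<le> stage_const \<tau> * M \<and> \<bar>V x\<bar> \<le> stage_const \<tau> * M \<and> \<bar>W x\<bar> \<le> stage_const \<tau> * M"
proof -
  have \<tau>: "\<tau> \<noteq> 0" and c1: "1/2 \<le> c1" "c1 \<le> 1" and c2: "1/2 \<le> c2" "c2 \<le> 1" and c3: "0 \<le> c3" "c3 \<le> 1"
    and \<epsilon>: "0 < \<epsilon>" "\<epsilon> \<le> 1" and small: "20 * \<epsilon>\<^sup>2 * \<bar>\<tau>\<bar> \<le> 1"
    using adm by (auto simp: admissible_coeffs_def)
  have \<epsilon>2: "0 \<le> \<epsilon>\<^sup>2" "\<epsilon>\<^sup>2 \<le> 1" using \<epsilon> by (auto simp: power_le_one)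
  have \<tau>2: "0 < \<tau>\<^sup>2" using \<tau> by simp
  have M0: "0 \<le> M" using M(1)[of 0] by linarith
  note eqs = sys[unfolded stage_system_def, rule_format]
  note deqs = stage_system_deriv[OF sys C, unfolded stage_system_def, rule_format]
  have "Ck_periodic L 1 (deriv V)" "Ck_periodic L 0 (deriv V)"
    using C(2) Ck_le[of L 1 "deriv V" 0] by (auto simp: Ck_deriv numeral_2_eq_2)
  then obtain x0 where x0: "\<And>x. \<bar>deriv V x\<bar> \<le> \<bar>deriv V x0\<bar>"
    using periodic_attains_abs_max[OF L, of "deriv V"] by (auto simp: Ck_0)
  \<comment> \<open>Finite by periodicity before any estimate is available; this is the quantity to
    be absorbed.\<close>
  define Y where "Y = \<bar>deriv V x0\<bar>"
  have Y: "\<And>x. \<bar>deriv V x\<bar> \<le> Y" "0 \<le> Y" using x0 by (auto simp: Y_def)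
  have W': "\<bar>deriv W x\<bar> \<le> M + \<bar>\<tau>\<bar> * Y" for x
  proof (rule transport_sup_bound[where f = "deriv W", OF L])
    show "Ck_periodic L 1 (deriv W)" using C(3) by (simp add: Ck_deriv numeral_2_eq_2)
    fix x
    have "deriv W x + (\<tau> * c3 * \<epsilon>\<^sup>2) * deriv (deriv W) x = deriv Rw x - \<tau> * deriv V x"
      using deqs[of x] by (simp add: algebra_simps)
    moreover have "\<bar>\<tau> * deriv V x\<bar> \<le> \<bar>\<tau>\<bar> * Y" by (simp add: abs_mult mult_left_mono Y)
    ultimately show "\<bar>deriv W x + (\<tau> * c3 * \<epsilon>\<^sup>2) * deriv (deriv W) x\<bar> \<le> M + \<bar>\<tau>\<bar> * Y"
      using M(5)[of x] by linarith
  qed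
  define g where "g = M + 2 * \<bar>\<tau>\<bar> * M + \<tau>\<^sup>2 * \<epsilon>\<^sup>2 * (M + \<bar>\<tau>\<bar> * Y)"
  have ell: "\<bar>(\<epsilon>\<^sup>2 + \<tau>\<^sup>2) * V x - (\<tau>\<^sup>2 * c1 * c2) * deriv (deriv V) x\<bar> \<le> g" for x
  proof -
    have u: "deriv U x = deriv Ru x - \<tau> * c1 * deriv (deriv V) x"
      and w: "W x = Rw x - \<tau> * (c3 * \<epsilon>\<^sup>2 * deriv W x + V x)"
      and v: "\<epsilon>\<^sup>2 * V x + \<tau> * (c2 * deriv U x - W x) = Sv x"
      using deqs[of x] eqs[of x] by (auto simp: algebra_simps)
    \<comment> \<open>The equation for v with \<open>u\<close> and \<open>w\<close> inserted. Each
      insertion contributes a second factor \<tau>, which gives the coefficients of \<open>V\<close>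
      and \<open>deriv (deriv V)\<close> the signs that the maximum principle needs.\<close>
    have id: "(\<epsilon>\<^sup>2 + \<tau>\<^sup>2) * V x - (\<tau>\<^sup>2 * c1 * c2) * deriv (deriv V) x =
        Sv x - \<tau> * c2 * deriv Ru x + \<tau> * Rw x - \<tau>\<^sup>2 * \<epsilon>\<^sup>2 * (c3 * deriv W x)"
      using v unfolding u w by (simp add: algebra_simps power2_eq_square)
    have b1: "\<bar>\<tau> * c2 * deriv Ru x\<bar> \<le> \<bar>\<tau>\<bar> * 1 * M"
      unfolding abs_mult using c2 M(2) by (intro mult_mono) auto
    have b2: "\<bar>\<tau> * Rw x\<bar> \<le> \<bar>\<tau>\<bar> * M"
      unfolding abs_mult using M(4) by (intro mult_left_mono) auto
    have "\<bar>c3 * deriv W x\<bar> \<le> 1 * (M + \<bar>\<tau>\<bar> * Y)"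
      unfolding abs_mult using c3 W' by (intro mult_mono) auto
    then have b3: "\<bar>\<tau>\<^sup>2 * \<epsilon>\<^sup>2 * (c3 * deriv W x)\<bar> \<le> \<tau>\<^sup>2 * \<epsilon>\<^sup>2 * (M + \<bar>\<tau>\<bar> * Y)"
      unfolding abs_mult[of "\<tau>\<^sup>2 * \<epsilon>\<^sup>2"] by (auto intro!: mult_left_mono)
    show ?thesis unfolding id g_def using b1 b2 b3 M(3)[of x] by (simp add: abs_le_iff)
  qed
  have V1: "(\<epsilon>\<^sup>2 + \<tau>\<^sup>2) * \<bar>V x\<bar> \<le> g" for x
    using helmholtz_sup_bound[OF L C(2) _ _ ell, of x] c1 c2 \<tau>2 \<epsilon>2 by (simp add: add_nonneg_pos)
  have V: "\<bar>V x\<bar> \<le> g / \<tau>\<^sup>2" for x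
  proof -
    have "\<tau>\<^sup>2 * \<bar>V x\<bar> \<le> (\<epsilon>\<^sup>2 + \<tau>\<^sup>2) * \<bar>V x\<bar>" by (intro mult_right_mono) auto
    with V1[of x] have "\<tau>\<^sup>2 * \<bar>V x\<bar> \<le> g" by (rule order_trans[rotated])
    with \<tau>2 show ?thesis by (simp add: field_simps)
  qed
  \<comment> \<open>8 = 2 * 4: the triangle inequality in \<open>ell\<close> gives
    \<open>2 * g\<close>, and \<open>c1 * c2\<close> is at least 1/4.\<close>
  have V'': "\<bar>deriv (deriv V) x\<bar> \<le> 8 * (g / \<tau>\<^sup>2)" for x
  proof -
    have "\<bar>(\<epsilon>\<^sup>2 + \<tau>\<^sup>2) * V x\<bar> \<le> g" using V1[of x] \<epsilon>2 \<tau>2 by (simp add: abs_mult)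
    then have b: "\<bar>(\<tau>\<^sup>2 * c1 * c2) * deriv (deriv V) x\<bar> \<le> 2 * g" using ell[of x] by (simp add: abs_le_iff)
    have "\<tau>\<^sup>2 / 4 \<le> \<tau>\<^sup>2 * c1 * c2"
      using mult_mono[of "1/2" c1 "1/2" c2] c1 c2 \<tau>2 mult_left_mono[of "1/4" "c1 * c2" "\<tau>\<^sup>2"]
      by (simp add: mult.assoc)
    then have "(\<tau>\<^sup>2 / 4) * \<bar>deriv (deriv V) x\<bar> \<le> (\<tau>\<^sup>2 * c1 * c2) * \<bar>deriv (deriv V) x\<bar>"
      by (rule mult_right_mono) simp
    also have "\<dots> = \<bar>(\<tau>\<^sup>2 * c1 * c2) * deriv (deriv V) x\<bar>"
      using c1 c2 by (simp add: abs_mult)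
    finally have "\<bar>deriv (deriv V) x\<bar> * \<tau>\<^sup>2 \<le> 8 * g" using b by (simp add: mult.commute)
    then show ?thesis using \<tau>2 by (simp add: pos_le_divide_eq)
  qed
  define B where "B = M * (20 * (1 + 2 * \<bar>\<tau>\<bar>) / \<tau>\<^sup>2 + 20)"
  \<comment> \<open>10 = 2 + 8 is the factor that \<open>landau_bound\<close> produces from the
    bounds for \<open>V\<close> and \<open>deriv (deriv V)\<close>. By \<open>small\<close>, the
    part of \<open>g\<close> that contains \<open>Y\<close> contributes at most
    \<open>Y / 2\<close>.\<close>
  have gB: "10 * (g / \<tau>\<^sup>2) \<le> B / 2 + Y / 2"
  proof -
    have "10 * (g / \<tau>\<^sup>2) = 10 * (1 + 2 * \<bar>\<tau>\<bar>) * M / \<tau>\<^sup>2 + 10 * (\<epsilon>\<^sup>2 * M) + (20 * \<epsilon>\<^sup>2 * \<bar>\<tau>\<bar>) * Y / 2"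
      using \<tau>2 unfolding g_def by (simp add: field_simps)
    moreover have "\<epsilon>\<^sup>2 * M \<le> M" using \<epsilon>2 M0 by (simp add: mult_left_le_one_le)
    moreover have "(20 * \<epsilon>\<^sup>2 * \<bar>\<tau>\<bar>) * Y \<le> Y" using small Y(2) by (intro mult_left_le_one_le) auto
    ultimately show ?thesis unfolding B_def by (simp add: field_simps)
  qed
  \<comment> \<open>Absorption: the interpolation gives
    \<open>Y \<le> B / 2 + Y / 2\<close>.\<close>
  have YB: "Y \<le> B"
    using landau_bound[OF C(2) V V'', of x0] gB unfolding Y_def by linarith
  have g0: "0 \<le> g / \<tau>\<^sup>2" using V[of 0] by linarith
  have VB: "\<bar>V x\<bar> \<le> B" for x using V[of x] gB YB g0 by linarith
  have B0: "0 \<le> B" using VB[of 0] by linarith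
  have cM: "stage_const \<tau> * M = M + B + \<bar>\<tau>\<bar> * B"
  proof -
    define c where "c = 20 * (1 + 2 * \<bar>\<tau>\<bar>) / \<tau>\<^sup>2 + 20"
    show ?thesis unfolding stage_const_def B_def c_def[symmetric] by (simp add: algebra_simps)
  qed
  have W: "\<bar>W x\<bar> \<le> M + \<bar>\<tau>\<bar> * B" for x
  proof (rule transport_sup_bound[where f = W, OF L])
    show "Ck_periodic L 1 W" using C(3) Ck_le by (metis one_le_numeral)
    fix x
    have "W x + (\<tau> * c3 * \<epsilon>\<^sup>2) * deriv W x = Rw x - \<tau> * V x"
      using eqs[of x] by (simp add: algebra_simps)
    moreover have "\<bar>\<tau> * V x\<bar> \<le> \<bar>\<tau>\<bar> * B" by (simp add: abs_mult mult_left_mono VB)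
    ultimately show "\<bar>W x + (\<tau> * c3 * \<epsilon>\<^sup>2) * deriv W x\<bar> \<le> M + \<bar>\<tau>\<bar> * B"
      using M(4)[of x] by linarith
  qed
  have U: "\<bar>U x\<bar> \<le> M + \<bar>\<tau>\<bar> * B" for x
  proof -
    have "\<bar>deriv V x\<bar> \<le> B" using Y(1)[of x] YB by linarith
    then have "\<bar>\<tau> * c1 * deriv V x\<bar> \<le> \<bar>\<tau>\<bar> * 1 * B"
      unfolding abs_mult using c1 by (intro mult_mono) auto
    then show ?thesis using eqs[of x] M(1)[of x] by (simp add: abs_le_iff)
  qed
  have "0 \<le> \<bar>\<tau>\<bar> * B" using B0 by simp
  then show ?thesis
    unfolding cM using U[of x] VB[of x] W[of x] M0 B0 by linarith
qed

text \<open>Of the two orders lost, one is the derivative of the data in the sup estimate; the other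
  makes the unknowns C^2, as the elimination requires. Higher orders follow by differentiating the
  system.\<close>

lemma stage_Ck_bounded:
  assumes L: "L > 0" and adm: "admissible_coeffs \<tau> c1 c2 c3 \<epsilon>"
  shows "stage_system \<tau> c1 c2 c3 \<epsilon> U V W Ru Sv Rw \<Longrightarrow>
    Ck_periodic L 1 U \<Longrightarrow> Ck_periodic L 1 V \<Longrightarrow> Ck_periodic L 1 W \<Longrightarrow>
    Ck_bounded L (k + 2) M Ru \<Longrightarrow> Ck_bounded L (k + 2) M Sv \<Longrightarrow> Ck_bounded L (k + 2) M Rw \<Longrightarrow>
    Ck_bounded L k (stage_const \<tau> * M) U \<and> Ck_bounded L k (stage_const \<tau> * M) V \<and>
    Ck_bounded L k (stage_const \<tau> * M) W"
proof (induction k arbitrary: U V W Ru Sv Rw)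
  case 0
  have C: "Ck_periodic L 2 U" "Ck_periodic L 2 V" "Ck_periodic L 2 W"
    using stage_regularity[OF L adm 0(1-4), of 1] 0(5-7)
    by (auto simp: Ck_bounded_imp_Ck numeral_2_eq_2)
  have *: "\<bar>f x\<bar> \<le> M" "\<bar>deriv f x\<bar> \<le> M" if "Ck_bounded L (0 + 2) M f" for f x
    using that by (auto simp: numeral_2_eq_2 Ck_bounded_Suc)
  show ?case
    using stage_sup_bound[OF L adm 0(1) C, of M] * 0(5-7) C[THEN Ck_le, of 0]
    by (auto simp: Ck_bounded_0 Ck_0)
next
  case (Suc k)
  have C: "Ck_periodic L (k + 3) U" "Ck_periodic L (k + 3) V" "Ck_periodic L (k + 3) W"
    using stage_regularity[OF L adm Suc.prems(1-4), of "k + 2"] Suc.prems(5-7)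
    by (auto simp: Ck_bounded_imp_Ck numeral_eq_Suc)
  have C2: "Ck_periodic L 2 U" "Ck_periodic L 2 V" "Ck_periodic L 2 W"
    using C Ck_le by (auto intro: Ck_le)
  have C': "Ck_periodic L 1 (deriv U)" "Ck_periodic L 1 (deriv V)" "Ck_periodic L 1 (deriv W)"
    using C2 by (auto simp: numeral_2_eq_2 Ck_deriv)
  have R: "Ck_bounded L (k + 2) M (deriv f)" "\<bar>f x\<bar> \<le> M" "\<bar>deriv f x\<bar> \<le> M"
    if "Ck_bounded L (Suc k + 2) M f" for f x
    using that by (auto simp: Ck_bounded_Suc)
  have d: "Ck_bounded L k (stage_const \<tau> * M) (deriv U) \<and> Ck_bounded L k (stage_const \<tau> * M) (deriv V) \<and>
    Ck_bounded L k (stage_const \<tau> * M) (deriv W)"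
    by (rule Suc.IH[OF stage_system_deriv[OF Suc.prems(1) C2] C']) (use Suc.prems(5-7) R in auto)
  have b: "\<bar>U x\<bar> \<le> stage_const \<tau> * M \<and> \<bar>V x\<bar> \<le> stage_const \<tau> * M \<and> \<bar>W x\<bar> \<le> stage_const \<tau> * M" for x
    by (rule stage_sup_bound[OF L adm Suc.prems(1) C2]) (use Suc.prems(5-7) R in auto)
  show ?case using d b C2 by (auto simp: Ck_bounded_Suc numeral_2_eq_2 Ck_Suc)
qed

section \<open>Families of order \<open>\<epsilon> ^ p\<close>\<close>

text \<open>\<open>p = 0\<close> expresses uniform boundedness in C^k; \<open>p = 1\<close> is the
  rate of all convergence statements below.\<close>

definition O_Ck :: "real \<Rightarrow> nat \<Rightarrow> nat \<Rightarrow> (real \<Rightarrow> real \<Rightarrow> real) \<Rightarrow> bool" where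
  "O_Ck L k p F \<longleftrightarrow> (\<exists>C. \<forall>\<^sub>F \<epsilon> in at_right 0. Ck_bounded L k (C * \<epsilon> ^ p) (F \<epsilon>))"

lemma at_right_0_small: "0 < c \<Longrightarrow> \<forall>\<^sub>F \<epsilon> in at_right (0::real). 0 < \<epsilon> \<and> \<epsilon> < c"
  by (auto simp: eventually_at_right_field)

lemma O_Ck_nonneg_const:
  assumes "O_Ck L k p F"
  obtains C where "C \<ge> 0" "\<forall>\<^sub>F \<epsilon> in at_right 0. Ck_bounded L k (C * \<epsilon> ^ p) (F \<epsilon>)"
proof -
  obtain C where C: "\<forall>\<^sub>F \<epsilon> in at_right 0. Ck_bounded L k (C * \<epsilon> ^ p) (F \<epsilon>)"
    using assms by (auto simp: O_Ck_def)
  have "\<forall>\<^sub>F \<epsilon> in at_right 0. Ck_bounded L k (\<bar>C\<bar> * \<epsilon> ^ p) (F \<epsilon>)"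
    using C at_right_0_small[of 1, simplified]
    by eventually_elim (auto intro: Ck_bounded_mono mult_right_mono)
  then show ?thesis using that[of "\<bar>C\<bar>"] by simp
qed

lemma O_Ck_mono:
  assumes F: "O_Ck L k q F" and "j \<le> k" "p \<le> q"
  shows "O_Ck L j p F"
proof -
  obtain C where C: "C \<ge> 0" "\<forall>\<^sub>F \<epsilon> in at_right 0. Ck_bounded L k (C * \<epsilon> ^ q) (F \<epsilon>)"
    using O_Ck_nonneg_const[OF F] .
  have "\<forall>\<^sub>F \<epsilon> in at_right 0. Ck_bounded L j (C * \<epsilon> ^ p) (F \<epsilon>)"
    using C(2) at_right_0_small[of 1, simplified]
  proof eventually_elim
    case (elim \<epsilon>)
    have "C * \<epsilon> ^ q \<le> C * \<epsilon> ^ p" using elim C(1) \<open>p \<le> q\<close> by (intro mult_left_mono power_decreasing) auto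
    then show ?case using elim(1) \<open>j \<le> k\<close> Ck_bounded_le Ck_bounded_mono by blast
  qed
  then show ?thesis by (auto simp: O_Ck_def)
qed

lemma O_Ck_cong:
  assumes "\<forall>\<^sub>F \<epsilon> in at_right 0. \<forall>x. F \<epsilon> x = G \<epsilon> x"
  shows "O_Ck L k p F \<longleftrightarrow> O_Ck L k p G"
proof -
  have *: "\<forall>\<^sub>F \<epsilon> in at_right 0. F \<epsilon> = G \<epsilon>" using assms by eventually_elim auto
  have "(\<forall>\<^sub>F \<epsilon> in at_right 0. Ck_bounded L k (C * \<epsilon> ^ p) (F \<epsilon>)) \<longleftrightarrow>
      (\<forall>\<^sub>F \<epsilon> in at_right 0. Ck_bounded L k (C * \<epsilon> ^ p) (G \<epsilon>))" for C
    by (rule eventually_cong[OF *]) auto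
  then show ?thesis by (simp add: O_Ck_def)
qed

lemma O_Ck_add:
  assumes "O_Ck L k p F" "O_Ck L k p G"
  shows "O_Ck L k p (\<lambda>\<epsilon> x. F \<epsilon> x + G \<epsilon> x)"
proof -
  obtain C D where
    CD: "\<forall>\<^sub>F \<epsilon> in at_right 0. Ck_bounded L k (C * \<epsilon> ^ p) (F \<epsilon>)"
    "\<forall>\<^sub>F \<epsilon> in at_right 0. Ck_bounded L k (D * \<epsilon> ^ p) (G \<epsilon>)"
    using assms by (auto simp: O_Ck_def)
  have "\<forall>\<^sub>F \<epsilon> in at_right 0. Ck_bounded L k ((C + D) * \<epsilon> ^ p) (\<lambda>x. F \<epsilon> x + G \<epsilon> x)"
    using CD by eventually_elim (auto simp: distrib_right intro: Ck_bounded_add)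
  then show ?thesis by (auto simp: O_Ck_def)
qed

lemma O_Ck_coeff:
  assumes "O_Ck L k p F" "\<forall>\<^sub>F \<epsilon> in at_right 0. \<bar>a \<epsilon>\<bar> \<le> B * \<epsilon> ^ r"
  shows "O_Ck L k (p + r) (\<lambda>\<epsilon> x. a \<epsilon> * F \<epsilon> x)"
proof -
  obtain C where C: "C \<ge> 0" "\<forall>\<^sub>F \<epsilon> in at_right 0. Ck_bounded L k (C * \<epsilon> ^ p) (F \<epsilon>)"
    using O_Ck_nonneg_const[OF assms(1)] .
  have "\<forall>\<^sub>F \<epsilon> in at_right 0. Ck_bounded L k ((B * C) * \<epsilon> ^ (p + r)) (\<lambda>x. a \<epsilon> * F \<epsilon> x)"
    using C(2) assms(2)
  proof eventually_elim
    case (elim \<epsilon>)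
    have "\<bar>a \<epsilon>\<bar> * (C * \<epsilon> ^ p) \<le> (B * \<epsilon> ^ r) * (C * \<epsilon> ^ p)"
      using elim Ck_bounded_nonneg[OF elim(1)] by (intro mult_right_mono) auto
    then show ?case
      using Ck_bounded_mono[OF Ck_bounded_cmult[OF elim(1), of "a \<epsilon>"]] by (simp add: power_add mult_ac)
  qed
  then show ?thesis by (auto simp: O_Ck_def)
qed

lemma O_Ck_cmult: "O_Ck L k p F \<Longrightarrow> O_Ck L k p (\<lambda>\<epsilon> x. a * F \<epsilon> x)"
  using O_Ck_coeff[of L k p F "\<lambda>_. a" "\<bar>a\<bar>" 0] by simp

lemma O_Ck_eps: "O_Ck L k p F \<Longrightarrow> O_Ck L k (Suc p) (\<lambda>\<epsilon> x. \<epsilon> * F \<epsilon> x)"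
  using O_Ck_coeff[of L k p F "\<lambda>\<epsilon>. \<epsilon>" 1 1] at_right_0_small[of 1]
  by (simp add: eventually_mono)

lemma O_Ck_eps1: "O_Ck L k 0 F \<Longrightarrow> O_Ck L k 1 (\<lambda>\<epsilon> x. \<epsilon> * F \<epsilon> x)"
  using O_Ck_eps[of L k 0 F] by simp

lemma O_Ck_diff:
  "O_Ck L k p F \<Longrightarrow> O_Ck L k p G \<Longrightarrow> O_Ck L k p (\<lambda>\<epsilon> x. F \<epsilon> x - G \<epsilon> x)"
  using O_Ck_add[of L k p F "\<lambda>\<epsilon> x. (-1) * G \<epsilon> x"] O_Ck_cmult[of L k p G "-1"] by simp

lemma O_Ck_mult:
  assumes "O_Ck L k p F" "O_Ck L k r G"
  shows "O_Ck L k (p + r) (\<lambda>\<epsilon> x. F \<epsilon> x * G \<epsilon> x)"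
proof -
  obtain C D where
    CD: "\<forall>\<^sub>F \<epsilon> in at_right 0. Ck_bounded L k (C * \<epsilon> ^ p) (F \<epsilon>)"
    "\<forall>\<^sub>F \<epsilon> in at_right 0. Ck_bounded L k (D * \<epsilon> ^ r) (G \<epsilon>)"
    using assms by (auto simp: O_Ck_def)
  have "\<forall>\<^sub>F \<epsilon> in at_right 0. Ck_bounded L k ((2 ^ k * C * D) * \<epsilon> ^ (p + r)) (\<lambda>x. F \<epsilon> x * G \<epsilon> x)"
    using CD
  proof eventually_elim
    case (elim \<epsilon>)
    show ?case using Ck_bounded_mult[OF elim] by (simp add: power_add mult_ac)
  qed
  then show ?thesis by (auto simp: O_Ck_def)
qed

lemma O_Ck_eps': "O_Ck L k p F \<Longrightarrow> O_Ck L k p (\<lambda>\<epsilon> x. \<epsilon> * F \<epsilon> x)"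
  using O_Ck_eps O_Ck_mono by (metis le_SucI order_refl)

lemma O_Ck_one_minus: "O_Ck L k p F \<Longrightarrow> O_Ck L k p (\<lambda>\<epsilon> x. (1 - d * \<epsilon>) * F \<epsilon> x)"
  using O_Ck_diff[of L k p F "\<lambda>\<epsilon> x. d * (\<epsilon> * F \<epsilon> x)"] O_Ck_cmult[of L k p "\<lambda>\<epsilon> x. \<epsilon> * F \<epsilon> x" d]
    O_Ck_eps'[of L k p F] by (simp add: algebra_simps)

lemma O_Ck_zero: "O_Ck L k p (\<lambda>\<epsilon> x. 0)"
  unfolding O_Ck_def by (rule exI[of _ 0]) (simp add: Ck_bounded_zero)

lemma O_Ck_sum: "(\<And>i. i \<in> I \<Longrightarrow> O_Ck L k p (F i)) \<Longrightarrow> O_Ck L k p (\<lambda>\<epsilon> x. \<Sum>i\<in>I. F i \<epsilon> x)"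
  by (induction I rule: infinite_finite_induct) (auto intro: O_Ck_add O_Ck_zero)

lemma O_Ck_deriv: "O_Ck L (Suc k) p F \<Longrightarrow> O_Ck L k p (\<lambda>\<epsilon>. deriv (F \<epsilon>))"
  unfolding O_Ck_def by (blast intro: eventually_mono dest: Ck_bounded_Suc[THEN iffD1])

lemma O_Ck_const: "L > 0 \<Longrightarrow> Ck_periodic L k f \<Longrightarrow> O_Ck L k 0 (\<lambda>\<epsilon>. f)"
  by (auto simp: O_Ck_def Ck_iff_bounded)

lemma O_Ck_imp_eventually_Ck: "O_Ck L k p F \<Longrightarrow> \<forall>\<^sub>F \<epsilon> in at_right 0. Ck_periodic L k (F \<epsilon>)"
  unfolding O_Ck_def by (auto elim!: eventually_mono simp: Ck_bounded_imp_Ck)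

text \<open>The separate bounds supply the differentiability that splits the derivative of the
  difference; the rate is that of the difference.\<close>

lemma O_Ck_deriv_diff:
  assumes F: "O_Ck L (Suc k) p F" and G: "O_Ck L (Suc k) q G"
    and FG: "O_Ck L (Suc k) r (\<lambda>\<epsilon> x. F \<epsilon> x - G \<epsilon> x)"
  shows "O_Ck L k r (\<lambda>\<epsilon> x. deriv (F \<epsilon>) x - deriv (G \<epsilon>) x)"
proof -
  have "\<forall>\<^sub>F \<epsilon> in at_right 0. \<forall>x. deriv (\<lambda>x. F \<epsilon> x - G \<epsilon> x) x = deriv (F \<epsilon>) x - deriv (G \<epsilon>) x"
    using F[THEN O_Ck_imp_eventually_Ck] G[THEN O_Ck_imp_eventually_Ck]
    by eventually_elim (auto simp: Ck_Suc)
  from O_Ck_cong[OF this] O_Ck_deriv[OF FG] show ?thesis by simp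
qed

text \<open>The bound of order \<open>q\<close> supplies the regularity for the maximum principle;
  the rate \<open>p\<close> is that of the right-hand side.\<close>

lemma O_Ck_helmholtz:
  assumes "L > 0" "O_Ck L (k + 2) q F" "O_Ck L k p (\<lambda>\<epsilon> x. F \<epsilon> x - deriv (deriv (F \<epsilon>)) x)"
  shows "O_Ck L k p F"
proof -
  obtain C where "\<forall>\<^sub>F \<epsilon> in at_right 0. Ck_bounded L k (C * \<epsilon> ^ p) (\<lambda>x. F \<epsilon> x - deriv (deriv (F \<epsilon>)) x)"
    using assms by (auto simp: O_Ck_def)
  then have "\<forall>\<^sub>F \<epsilon> in at_right 0. Ck_bounded L k (C * \<epsilon> ^ p) (F \<epsilon>)"
    using O_Ck_imp_eventually_Ck[OF assms(2)]
    by eventually_elim (auto intro: Ck_bounded_helmholtz assms(1))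
  then show ?thesis by (auto simp: O_Ck_def)
qed

lemma deriv_funpow_diff:
  "Ck_periodic L m f \<Longrightarrow> Ck_periodic L m g \<Longrightarrow> j \<le> m \<Longrightarrow>
   (deriv ^^ j) (\<lambda>x. f x - g x) = (\<lambda>x. (deriv ^^ j) f x - (deriv ^^ j) g x)"
proof (induction j)
  case (Suc j)
  then have "(deriv ^^ j) f field_differentiable at x" "(deriv ^^ j) g field_differentiable at x" for x
    by (auto simp: Ck_periodic_def)
  with Suc show ?case by auto
qed simp

lemma O_Ck_imp_Cm_limit:
  assumes L: "L > 0" and F: "O_Ck L m 1 (\<lambda>\<epsilon> x. F \<epsilon> x - \<phi> x)" and \<phi>: "Ck_periodic L m \<phi>"
  shows "Cm_limit L m F \<phi>"
proof -
  obtain C where C: "C \<ge> 0" "\<forall>\<^sub>F \<epsilon> in at_right 0. Ck_bounded L m (C * \<epsilon> ^ 1) (\<lambda>x. F \<epsilon> x - \<phi> x)"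
    using O_Ck_nonneg_const[OF F] .
  have Ck: "\<forall>\<^sub>F \<epsilon> in at_right 0. Ck_periodic L m (F \<epsilon>)"
    using O_Ck_imp_eventually_Ck[OF F]
  proof eventually_elim
    case (elim \<epsilon>)
    show ?case using Ck_add[OF L elim \<phi>] by simp
  qed
  have "uniform_limit UNIV (\<lambda>\<epsilon>. (deriv ^^ j) (F \<epsilon>)) ((deriv ^^ j) \<phi>) (at_right 0)" if "j \<le> m" for j
  proof (rule uniform_limitI)
    fix e :: real assume "e > 0"
    then have "\<forall>\<^sub>F \<epsilon> in at_right (0::real). 0 < \<epsilon> \<and> \<epsilon> < e / (C + 1)"
      using C(1) by (intro at_right_0_small) auto
    then show "\<forall>\<^sub>F \<epsilon> in at_right 0. \<forall>x\<in>UNIV. dist ((deriv ^^ j) (F \<epsilon>) x) ((deriv ^^ j) \<phi> x) < e"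
      using C(2) Ck
    proof eventually_elim
      case (elim \<epsilon>)
      have "C * \<epsilon> < e"
        using elim(1) C(1) by (auto simp: field_simps)
      moreover have "\<bar>(deriv ^^ j) (F \<epsilon>) x - (deriv ^^ j) \<phi> x\<bar> \<le> C * \<epsilon>" for x
        using elim(2) that deriv_funpow_diff[OF elim(3) \<phi> that] by (auto simp: Ck_bounded_def)
      ultimately show ?case by (auto simp: dist_real_def intro: le_less_trans)
    qed
  qed
  with Ck \<phi> show ?thesis by (auto simp: Cm_limit_def)
qed

lemma O_Ck_stage:
  assumes L: "L > 0" and \<tau>: "\<tau> \<noteq> 0" and \<delta>: "\<delta>1 \<in> {0..1}" "\<delta>2 \<in> {0..1}" "\<delta>3 \<in> {0..1}"
    and sys: "\<forall>\<^sub>F \<epsilon> in at_right 0. stage_system \<tau> (1 - \<delta>1 * \<epsilon>) (1 - \<delta>2 * \<epsilon>) (1 - \<delta>3) \<epsilon>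
        (U \<epsilon>) (V \<epsilon>) (W \<epsilon>) (Ru \<epsilon>) (Sv \<epsilon>) (Rw \<epsilon>)"
    and C1: "\<forall>\<^sub>F \<epsilon> in at_right 0. Ck_periodic L 1 (U \<epsilon>) \<and> Ck_periodic L 1 (V \<epsilon>) \<and> Ck_periodic L 1 (W \<epsilon>)"
    and R: "O_Ck L (k + 2) 0 Ru" "O_Ck L (k + 2) 0 Sv" "O_Ck L (k + 2) 0 Rw"
  shows "O_Ck L k 0 U \<and> O_Ck L k 0 V \<and> O_Ck L k 0 W"
proof -
  obtain C1 C2 C3 where C:
    "\<forall>\<^sub>F \<epsilon> in at_right 0. Ck_bounded L (k + 2) C1 (Ru \<epsilon>)"
    "\<forall>\<^sub>F \<epsilon> in at_right 0. Ck_bounded L (k + 2) C2 (Sv \<epsilon>)"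
    "\<forall>\<^sub>F \<epsilon> in at_right 0. Ck_bounded L (k + 2) C3 (Rw \<epsilon>)"
    using R by (auto simp: O_Ck_def)
  define M where "M = max C1 (max C2 C3)"
  \<comment> \<open>The first bound keeps \<open>1 - \<delta>1 * \<epsilon>\<close> and
    \<open>1 - \<delta>2 * \<epsilon>\<close> at least 1/2. The second gives the absorption
    condition, because \<epsilon>^2 is at most \<epsilon>.\<close>
  have "0 < min (1/2) (1 / (20 * \<bar>\<tau>\<bar>))" using \<tau> by simp
  from at_right_0_small[OF this]
  have "\<forall>\<^sub>F \<epsilon> in at_right 0. admissible_coeffs \<tau> (1 - \<delta>1 * \<epsilon>) (1 - \<delta>2 * \<epsilon>) (1 - \<delta>3) \<epsilon>"
  proof eventually_elim
    case (elim \<epsilon>)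
    have "\<epsilon>\<^sup>2 \<le> \<epsilon>" using elim power_decreasing[of 1 2 \<epsilon>] by simp
    moreover have "\<epsilon> * (20 * \<bar>\<tau>\<bar>) \<le> 1" using elim \<tau> by (auto simp: field_simps)
    ultimately have "20 * \<epsilon>\<^sup>2 * \<bar>\<tau>\<bar> \<le> 1"
      using mult_right_mono[of "\<epsilon>\<^sup>2" \<epsilon> "20 * \<bar>\<tau>\<bar>"] by (simp add: mult_ac)
    moreover have "0 \<le> d * \<epsilon> \<and> d * \<epsilon> \<le> 1/2" if "d \<in> {0..1}" for d
      using that elim mult_mono[of d 1 \<epsilon> "1/2"] by auto
    ultimately show ?case using \<delta> elim \<tau> by (fastforce simp: admissible_coeffs_def)
  qed
  with sys C1 C have "\<forall>\<^sub>F \<epsilon> in at_right 0. Ck_bounded L k (stage_const \<tau> * M) (U \<epsilon>) \<and>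
      Ck_bounded L k (stage_const \<tau> * M) (V \<epsilon>) \<and> Ck_bounded L k (stage_const \<tau> * M) (W \<epsilon>)"
  proof eventually_elim
    case (elim \<epsilon>)
    then have "Ck_bounded L (k + 2) M (Ru \<epsilon>)" "Ck_bounded L (k + 2) M (Sv \<epsilon>)" "Ck_bounded L (k + 2) M (Rw \<epsilon>)"
      unfolding M_def by (auto elim: Ck_bounded_mono)
    with elim show ?case using stage_Ck_bounded[OF L elim(6) elim(1)] by blast
  qed
  then show ?thesis unfolding O_Ck_def by (auto simp: eventually_conj_iff)
qed

section \<open>The BBM scheme and type II tableaux\<close>

lemma bbm_increment:
  assumes "dt \<noteq> 0" and e: "Ck_periodic L 2 e" and \<eta>: "Ck_periodic L 2 \<eta>"
    and eq: "id_minus_dxx (\<lambda>y. (e y - \<eta> y) / dt) x = - S"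
  shows "e x - deriv (deriv e) x = \<eta> x - deriv (deriv \<eta>) x - dt * (S :: real)"
proof -
  note D = Ck2_DERIV[where L = L]
  have 1: "deriv (\<lambda>y. (e y - \<eta> y) / dt) = (\<lambda>y. (deriv e y - deriv \<eta> y) / dt)"
    by (intro ext DERIV_imp_deriv DERIV_cdivide DERIV_diff D e \<eta>)
  have 2: "deriv (\<lambda>y. (deriv e y - deriv \<eta> y) / dt) = (\<lambda>y. (deriv (deriv e) y - deriv (deriv \<eta>) y) / dt)"
    by (intro ext DERIV_imp_deriv DERIV_cdivide DERIV_diff D e \<eta>)
  have "((e x - deriv (deriv e) x) - (\<eta> x - deriv (deriv \<eta>) x)) / dt = - S"
    using eq unfolding id_minus_dxx_def 1 2 by (simp add: diff_divide_distrib)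
  then show ?thesis using \<open>dt \<noteq> 0\<close> by (simp add: divide_eq_eq algebra_simps)
qed

text \<open>The right side contains at most two derivatives of the old state and one of the earlier
  stages, and inverting I - d_xx regains two. So the BBM scheme loses no regularity.\<close>

lemma Ck_bbm_stage:
  assumes L: "L > 0" and e: "Ck_periodic L 2 e" and \<eta>: "Ck_periodic L (Suc (Suc k)) \<eta>"
    and E: "\<And>j. j < i \<Longrightarrow> Ck_periodic L (Suc (Suc k)) (E j)"
    and eq: "\<And>x. e x - deriv (deriv e) x =
      \<eta> x - deriv (deriv \<eta>) x - dt * (\<Sum>j<i::nat. c j * (E j x * deriv (E j) x))"
  shows "Ck_periodic L (Suc (Suc k)) e"
proof -
  have E': "Ck_periodic L k (E j)" "Ck_periodic L k (deriv (E j))" if "j < i" for j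
    using Ck_le[OF E[OF that], of k] Ck_le[OF Ck_deriv[OF E[OF that]], of k] by auto
  have "Ck_periodic L k (\<lambda>x. e x - deriv (deriv e) x)"
    unfolding eq using E' \<eta> Ck_le[OF \<eta>, of k]
    by (intro Ck_diff Ck_cmult Ck_sum Ck_mult L) (auto simp: Ck_Suc)
  from Ck_helmholtz_regularity[OF L e this] show ?thesis by simp
qed

text \<open>The BBM scheme prescribes its stages and the new step only through I - d_xx; injectivity
  is what allows the new step to be identified with the last stage.\<close>

lemma helmholtz_unique:
  assumes L: "L > 0" and f: "Ck_periodic L 2 f" and g: "Ck_periodic L 2 g"
    and eq: "\<And>x. f x - deriv (deriv f) x = g x - deriv (deriv g) x"
  shows "f = g"
proof
  fix x
  note D = Ck2_DERIV[where L = L]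
  have 1: "deriv (\<lambda>y. f y - g y) = (\<lambda>y. deriv f y - deriv g y)"
    by (intro ext DERIV_imp_deriv DERIV_diff D f g)
  have 2: "deriv (\<lambda>y. deriv f y - deriv g y) = (\<lambda>y. deriv (deriv f) y - deriv (deriv g) y)"
    by (intro ext DERIV_imp_deriv DERIV_diff D f g)
  have "1 * \<bar>f x - g x\<bar> \<le> 0"
    by (rule helmholtz_sup_bound[where f = "\<lambda>y. f y - g y" and a = 1, OF L Ck_diff[OF L f g]])
      (use eq in \<open>auto simp: 1 2 algebra_simps\<close>)
  then show "f x = g x" by simp
qed

section \<open>Diagonal and inverse of the implicit block\<close>

lemma invertible_lower_triangular_diag:
  fixes M :: "real mat"
  assumes M: "M \<in> carrier_mat n n" and inv: "invertible_mat M"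
    and lt: "\<And>i j. i < j \<Longrightarrow> j < n \<Longrightarrow> M $$ (i, j) = 0" and "i < n"
  shows "M $$ (i, i) \<noteq> 0"
proof
  assume "M $$ (i, i) = 0"
  then have "0 \<in> set (diag_mat M)"
    using M \<open>i < n\<close> by (auto simp: diag_mat_def image_iff intro!: bexI[of _ i])
  then have "Determinant.det M = 0" using det_lower_triangular[OF lt M] by (simp add: prod_list_zero_iff)
  moreover obtain N where N: "M * N = 1\<^sub>m n" "N * M = 1\<^sub>m (dim_row N)"
    using inv M by (auto simp: invertible_mat_def inverts_mat_def)
  then have "N \<in> carrier_mat n n"
    using M by (metis carrier_matD(2) carrier_matI index_mult_mat(3) index_one_mat(3))
  then have "Determinant.det M * Determinant.det N = 1" using det_mult[OF M, of N] N(1) by simp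
  ultimately show False by simp
qed

text \<open>\<open>mat_inverse\<close> yields \<open>None\<close> only for non-units of the matrix
  ring. The two-sided inverse from \<open>invertible_mat\<close>, once shown to be square of size
  \<open>n\<close>, excludes this.\<close>

lemma mat_inverse_left_inverse:
  fixes M :: "real mat"
  assumes M: "M \<in> carrier_mat n n" and inv: "invertible_mat M"
  shows "the (mat_inverse M) * M = 1\<^sub>m n" "the (mat_inverse M) \<in> carrier_mat n n"
proof -
  obtain N where N: "M * N = 1\<^sub>m n" "N * M = 1\<^sub>m (dim_row N)"
    using inv M by (auto simp: invertible_mat_def inverts_mat_def)
  then have "N \<in> carrier_mat n n"
    using M by (metis carrier_matD(2) carrier_matI index_mult_mat(3) index_one_mat(3))
  with N M have "M \<in> Units (ring_mat TYPE(real) n ())"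
    by (auto simp: Units_def ring_mat_def)
  with mat_inverse(1)[OF M, where b = "()"] obtain B where "mat_inverse M = Some B" by (cases "mat_inverse M") auto
  with mat_inverse(2)[OF M] show "the (mat_inverse M) * M = 1\<^sub>m n" "the (mat_inverse M) \<in> carrier_mat n n"
    by auto
qed

text \<open>Row and column 0 form the border of the block matrix, hence the shift by
  \<open>Suc\<close>. The last claim makes \<tau> nonzero at every stage but the first; it holds
  because \<open>Ah\<close> is triangular and invertible.\<close>

lemma type_II_entries:
  assumes "dirk_imex_tableau s At bt A b" and II: "type_II s A b \<alpha>h Ah \<beta>h bh"
  shows "A $$ (0, 0) = 0"
    and "\<And>i j. i < s - 1 \<Longrightarrow> j < s - 1 \<Longrightarrow> A $$ (Suc i, Suc j) = Ah $$ (i, j)"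
    and "\<And>i. i < s - 1 \<Longrightarrow> A $$ (Suc i, 0) = \<alpha>h $ i"
    and "\<And>i. 0 < i \<Longrightarrow> i < s \<Longrightarrow> A $$ (i, i) \<noteq> 0"
proof -
  have s: "2 \<le> s" and Ah: "Ah \<in> carrier_mat (s - 1) (s - 1)" and \<alpha>h: "\<alpha>h \<in> carrier_vec (s - 1)"
    and A: "A = four_block_mat (0\<^sub>m 1 1) (0\<^sub>m 1 (s - 1)) (mat_of_cols (s - 1) [\<alpha>h]) Ah"
    and inv: "invertible_mat Ah"
    using II by (auto simp: type_II_def)
  show "A $$ (0, 0) = 0" unfolding A using Ah s by simp
  show entry: "A $$ (Suc i, Suc j) = Ah $$ (i, j)" if "i < s - 1" "j < s - 1" for i j
    unfolding A using that Ah by simp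
  show "A $$ (Suc i, 0) = \<alpha>h $ i" if "i < s - 1" for i
    unfolding A using that Ah by (simp add: mat_of_cols_index)
  show "A $$ (i, i) \<noteq> 0" if "0 < i" "i < s" for i
  proof -
    have "Ah $$ (i', j) = 0" if "i' < j" "j < s - 1" for i' j
      using entry[of i' j] that assms(1) by (auto simp: dirk_imex_tableau_def)
    from invertible_lower_triangular_diag[OF Ah inv this, of "i - 1"] that show ?thesis
      using entry[of "i - 1" "i - 1"] by simp
  qed
qed

section \<open>One step of the method\<close>

text \<open>One time step for a whole family in \<epsilon>, with BBMH equations required only for
  small \<epsilon>. Powers of \<epsilon> in front of derivatives are nested factors, so that the
  \<open>O_Ck\<close> rules for multiplication by \<epsilon> apply syntactically.\<close>

locale imex_bbmh_family =
  fixes \<delta>1 \<delta>2 \<delta>3 L dt :: real and s :: nat and At A :: "real mat"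
    and u0 v0 w0 :: "real \<Rightarrow> real \<Rightarrow> real" and U V W :: "nat \<Rightarrow> real \<Rightarrow> real \<Rightarrow> real"
    and \<eta> :: "real \<Rightarrow> real" and E :: "nat \<Rightarrow> real \<Rightarrow> real"
  assumes \<delta>: "\<delta>1 \<in> {0..1}" "\<delta>2 \<in> {0..1}" "\<delta>3 \<in> {0..1}"
    and L: "L > 0" and dt: "dt > 0"
    and A00: "A $$ (0, 0) = 0" and Adiag: "0 < i \<Longrightarrow> i < s \<Longrightarrow> A $$ (i, i) \<noteq> 0"
    and C1: "i < s \<Longrightarrow> \<forall>\<^sub>F \<epsilon> in at_right 0.
      Ck_periodic L 1 (U i \<epsilon>) \<and> Ck_periodic L 1 (V i \<epsilon>) \<and> Ck_periodic L 1 (W i \<epsilon>)"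
    and U_eq: "i < s \<Longrightarrow> \<forall>\<^sub>F \<epsilon> in at_right 0. \<forall>x. U i \<epsilon> x = u0 \<epsilon> x
      - dt * (\<Sum>j<i. At $$ (i, j) * (U j \<epsilon> x * deriv (U j \<epsilon>) x + \<delta>1 * (\<epsilon> * deriv (V j \<epsilon>) x)))
      - dt * (\<Sum>j\<le>i. A $$ (i, j) * ((1 - \<delta>1 * \<epsilon>) * deriv (V j \<epsilon>) x))"
    and V_eq': "i < s \<Longrightarrow> \<forall>\<^sub>F \<epsilon> in at_right 0. \<forall>x. \<epsilon>\<^sup>2 * V i \<epsilon> x = \<epsilon>\<^sup>2 * v0 \<epsilon> x
      - dt * (\<Sum>j<i. At $$ (i, j) * (\<delta>2 * (\<epsilon> * deriv (U j \<epsilon>) x)))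
      - dt * (\<Sum>j\<le>i. A $$ (i, j) * ((1 - \<delta>2 * \<epsilon>) * deriv (U j \<epsilon>) x - W j \<epsilon> x))"
    and W_eq: "i < s \<Longrightarrow> \<forall>\<^sub>F \<epsilon> in at_right 0. \<forall>x. W i \<epsilon> x = w0 \<epsilon> x
      - dt * (\<Sum>j<i. At $$ (i, j) * (\<delta>3 * (\<epsilon> * (\<epsilon> * deriv (W j \<epsilon>) x))))
      - dt * (\<Sum>j\<le>i. A $$ (i, j) * ((1 - \<delta>3) * (\<epsilon> * (\<epsilon> * deriv (W j \<epsilon>) x)) + V j \<epsilon> x))"
    and E_eq: "i < s \<Longrightarrow> E i x - deriv (deriv (E i)) x = \<eta> x - deriv (deriv \<eta>) x
      - dt * (\<Sum>j<i. At $$ (i, j) * (E j x * deriv (E j) x))"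
begin

text \<open>The bracket that the equation for v divides by \<epsilon>^2; its smallness expresses w =
  u_x + O(\<epsilon>).\<close>

definition Z :: "nat \<Rightarrow> real \<Rightarrow> real \<Rightarrow> real" where
  "Z j \<epsilon> x = (1 - \<delta>2 * \<epsilon>) * deriv (U j \<epsilon>) x - W j \<epsilon> x"

lemmas V_eq = V_eq'[folded Z_def]

text \<open>The invariant carried from step to step, with v merely bounded.\<close>

definition start :: "nat \<Rightarrow> bool" where
  "start k \<longleftrightarrow> O_Ck L k 1 (\<lambda>\<epsilon> x. u0 \<epsilon> x - \<eta> x) \<and> O_Ck L k 0 v0 \<and>
     O_Ck L k 1 (\<lambda>\<epsilon> x. w0 \<epsilon> x - deriv \<eta> x)"

text \<open>\<open>Z\<close> is included with order 1 because it enters the equation for v of every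
  later stage, where order 1 is needed again.\<close>

definition stage_bounded :: "nat \<Rightarrow> nat \<Rightarrow> bool" where
  "stage_bounded k j \<longleftrightarrow> O_Ck L k 0 (U j) \<and> O_Ck L k 0 (V j) \<and> O_Ck L k 0 (W j) \<and> O_Ck L k 1 (Z j)"

definition stage_close :: "nat \<Rightarrow> nat \<Rightarrow> bool" where
  "stage_close k j \<longleftrightarrow> O_Ck L k 1 (\<lambda>\<epsilon> x. U j \<epsilon> x - E j x) \<and>
     O_Ck L k 1 (\<lambda>\<epsilon> x. W j \<epsilon> x - deriv (E j) x)"

lemma start_mono: "start k \<Longrightarrow> l \<le> k \<Longrightarrow> start l"
  by (auto simp: start_def intro: O_Ck_mono)

lemma stage_bounded_mono: "stage_bounded k j \<Longrightarrow> l \<le> k \<Longrightarrow> stage_bounded l j"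
  by (auto simp: stage_bounded_def intro: O_Ck_mono)

lemma stage_close_mono: "stage_close k j \<Longrightarrow> l \<le> k \<Longrightarrow> stage_close l j"
  by (auto simp: stage_close_def intro: O_Ck_mono)

lemma start_bounded:
  assumes "start k" "Ck_periodic L (Suc k) \<eta>"
  shows "O_Ck L k 0 u0" "O_Ck L k 0 v0" "O_Ck L k 0 w0"
proof -
  have c: "O_Ck L k 0 (\<lambda>\<epsilon> x. u0 \<epsilon> x - \<eta> x)" "O_Ck L k 0 (\<lambda>\<epsilon> x. w0 \<epsilon> x - deriv \<eta> x)"
    using assms(1) O_Ck_mono[of L k 1 _ k 0] by (auto simp: start_def)
  show "O_Ck L k 0 u0"
    using O_Ck_add[OF c(1) O_Ck_const[OF L Ck_le[OF assms(2), of k]]] by simp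
  show "O_Ck L k 0 w0"
    using O_Ck_add[OF c(2) O_Ck_const[OF L Ck_deriv[OF assms(2)]]] by simp
  show "O_Ck L k 0 v0" using assms by (simp add: start_def)
qed

text \<open>Since \<open>A $$ (0, 0) = 0\<close>, this stage is the old state. The smallness of
  \<open>Z 0\<close> is read off from \<open>start\<close> at the cost of one derivative of
  \<open>u0\<close>.\<close>

lemma stage_bounded_zero:
  assumes "0 < s" and st: "start (Suc k)" and \<eta>: "Ck_periodic L (k + 2) \<eta>"
  shows "stage_bounded k 0"
proof -
  have b: "O_Ck L (Suc k) 0 u0" "O_Ck L (Suc k) 0 v0" "O_Ck L (Suc k) 0 w0"
    using start_bounded[OF st] \<eta> by auto
  have e: "\<forall>\<^sub>F \<epsilon> in at_right 0. \<forall>x. U 0 \<epsilon> x = u0 \<epsilon> x"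
    "\<forall>\<^sub>F \<epsilon> in at_right 0. \<forall>x. W 0 \<epsilon> x = w0 \<epsilon> x"
    using U_eq[OF assms(1)] W_eq[OF assms(1)] A00 by (auto elim!: eventually_mono)
  have eV: "\<forall>\<^sub>F \<epsilon> in at_right 0. \<forall>x. V 0 \<epsilon> x = v0 \<epsilon> x"
    using V_eq[OF assms(1)] at_right_0_small[of 1, simplified] by eventually_elim (auto simp: A00)
  have "\<forall>\<^sub>F \<epsilon> in at_right 0. \<forall>x. Z 0 \<epsilon> x =
      (deriv (u0 \<epsilon>) x - deriv \<eta> x) - (w0 \<epsilon> x - deriv \<eta> x) - \<delta>2 * (\<epsilon> * deriv (u0 \<epsilon>) x)"
    using e
  proof eventually_elim
    case (elim \<epsilon>)
    then have "U 0 \<epsilon> = u0 \<epsilon>" by auto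
    then show ?case using elim(2) unfolding Z_def by (auto simp: algebra_simps)
  qed
  moreover have "O_Ck L k 1 (\<lambda>\<epsilon> x. deriv (u0 \<epsilon>) x - deriv \<eta> x)"
    using st \<eta> b by (intro O_Ck_deriv_diff[where p = 0 and q = 0] O_Ck_const L) (auto simp: start_def intro: Ck_le)
  moreover have "O_Ck L k 1 (\<lambda>\<epsilon> x. w0 \<epsilon> x - deriv \<eta> x)"
    using st by (auto simp: start_def intro: O_Ck_mono)
  moreover have "O_Ck L k 1 (\<lambda>\<epsilon> x. \<delta>2 * (\<epsilon> * deriv (u0 \<epsilon>) x))"
    using O_Ck_cmult[OF O_Ck_eps[OF O_Ck_deriv[OF b(1)]]] by simp
  ultimately have "O_Ck L k 1 (Z 0)"
    using O_Ck_diff[OF O_Ck_diff] by (simp only: O_Ck_cong)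
  then show ?thesis
    unfolding stage_bounded_def O_Ck_cong[OF e(1)] O_Ck_cong[OF e(2)] O_Ck_cong[OF eV]
    using b by (auto intro: O_Ck_mono)
qed

text \<open>Three orders are lost: one to the derivatives of earlier stages in the right-hand sides,
  two to the estimate of the implicit stage.\<close>

lemma stage_bounded_step:
  assumes i: "i < s" and prev: "\<And>j. j < i \<Longrightarrow> stage_bounded (k + 3) j"
    and st: "start (k + 3)" and \<eta>: "Ck_periodic L (k + 4) \<eta>"
  shows "stage_bounded k i"
proof (cases "i = 0")
  case True
  then show ?thesis
    using stage_bounded_zero[of k] i start_mono[OF st, of "Suc k"] Ck_le[OF \<eta>, of "k + 2"] by simp
next
  case False
  define \<tau> where "\<tau> = dt * A $$ (i, i)"
  have \<tau>: "\<tau> \<noteq> 0" using Adiag[of i] False i dt by (simp add: \<tau>_def)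
  define Ru where "Ru = (\<lambda>\<epsilon> x. u0 \<epsilon> x
      - dt * (\<Sum>j<i. At $$ (i, j) * (U j \<epsilon> x * deriv (U j \<epsilon>) x + \<delta>1 * (\<epsilon> * deriv (V j \<epsilon>) x)))
      - dt * (\<Sum>j<i. A $$ (i, j) * ((1 - \<delta>1 * \<epsilon>) * deriv (V j \<epsilon>) x)))"
  define Sv where "Sv = (\<lambda>\<epsilon> x. \<epsilon> * (\<epsilon> * v0 \<epsilon> x)
      - dt * (\<Sum>j<i. At $$ (i, j) * (\<delta>2 * (\<epsilon> * deriv (U j \<epsilon>) x)))
      - dt * (\<Sum>j<i. A $$ (i, j) * Z j \<epsilon> x))"
  define Rw where "Rw = (\<lambda>\<epsilon> x. w0 \<epsilon> x
      - dt * (\<Sum>j<i. At $$ (i, j) * (\<delta>3 * (\<epsilon> * (\<epsilon> * deriv (W j \<epsilon>) x))))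
      - dt * (\<Sum>j<i. A $$ (i, j) * ((1 - \<delta>3) * (\<epsilon> * (\<epsilon> * deriv (W j \<epsilon>) x)) + V j \<epsilon> x)))"
  have b: "O_Ck L (k + 2) 0 u0" "O_Ck L (k + 2) 0 v0" "O_Ck L (k + 2) 0 w0"
    using start_bounded[OF start_mono[OF st]] Ck_le[OF \<eta>] by auto
  have p: "O_Ck L (k + 2) 0 (U j)" "O_Ck L (k + 2) 0 (V j)" "O_Ck L (k + 2) 0 (W j)" "O_Ck L (k + 2) 1 (Z j)"
    "O_Ck L (k + 2) 0 (\<lambda>\<epsilon>. deriv (U j \<epsilon>))" "O_Ck L (k + 2) 0 (\<lambda>\<epsilon>. deriv (V j \<epsilon>))"
    "O_Ck L (k + 2) 0 (\<lambda>\<epsilon>. deriv (W j \<epsilon>))" if "j < i" for j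
    using prev[OF that]
    by (auto simp: stage_bounded_def eval_nat_numeral intro: O_Ck_mono O_Ck_deriv)
  have Ru: "O_Ck L (k + 2) 0 Ru"
    unfolding Ru_def
    by (intro O_Ck_diff O_Ck_cmult O_Ck_sum O_Ck_add O_Ck_mult[where p = 0 and r = 0, simplified]
        O_Ck_eps' O_Ck_one_minus b p) auto
  have Rw: "O_Ck L (k + 2) 0 Rw"
    unfolding Rw_def by (intro O_Ck_diff O_Ck_cmult O_Ck_sum O_Ck_add O_Ck_eps' b p) auto
  \<comment> \<open>Order 1: the old v carries \<epsilon>^2, the explicit part carries \<epsilon>,
    and the earlier \<open>Z j\<close> have order 1 by assumption.\<close>
  have Sv: "O_Ck L (k + 2) 1 Sv"
    unfolding Sv_def
    by (intro O_Ck_diff O_Ck_cmult O_Ck_sum O_Ck_eps1 O_Ck_eps' b p) auto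
  have split: "(\<Sum>j\<le>i. f j) = (\<Sum>j<i. f j) + f i" for f :: "nat \<Rightarrow> real"
    by (simp flip: lessThan_Suc_atMost)
  have sys: "\<forall>\<^sub>F \<epsilon> in at_right 0. stage_system \<tau> (1 - \<delta>1 * \<epsilon>) (1 - \<delta>2 * \<epsilon>) (1 - \<delta>3) \<epsilon>
      (U i \<epsilon>) (V i \<epsilon>) (W i \<epsilon>) (Ru \<epsilon>) (Sv \<epsilon>) (Rw \<epsilon>)"
    using U_eq[OF i] V_eq[OF i] W_eq[OF i]
  proof eventually_elim
    case (elim \<epsilon>)
    show ?case
      unfolding stage_system_def
    proof (intro allI conjI)
      fix x
      show "U i \<epsilon> x + \<tau> * (1 - \<delta>1 * \<epsilon>) * deriv (V i \<epsilon>) x = Ru \<epsilon> x"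
        using elim(1)[rule_format, of x] unfolding split Ru_def \<tau>_def by (simp add: algebra_simps)
      show "\<epsilon>\<^sup>2 * V i \<epsilon> x + \<tau> * ((1 - \<delta>2 * \<epsilon>) * deriv (U i \<epsilon>) x - W i \<epsilon> x) = Sv \<epsilon> x"
        using elim(2)[rule_format, of x] unfolding split Sv_def \<tau>_def Z_def[of i]
        by (simp add: algebra_simps power2_eq_square)
      show "W i \<epsilon> x + \<tau> * ((1 - \<delta>3) * \<epsilon>\<^sup>2 * deriv (W i \<epsilon>) x + V i \<epsilon> x) = Rw \<epsilon> x"
        using elim(3)[rule_format, of x] unfolding split Rw_def \<tau>_def
        by (simp add: algebra_simps power2_eq_square)
    qed
  qed
  have UVW: "O_Ck L k 0 (U i) \<and> O_Ck L k 0 (V i) \<and> O_Ck L k 0 (W i)"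
    using O_Ck_stage[OF L \<tau> \<delta> sys C1[OF i] Ru O_Ck_mono[OF Sv] Rw] by simp
  \<comment> \<open>Now that \<open>V i\<close> is bounded, the equation for v can be solved for
    \<open>Z i\<close>, which inherits the order of \<open>Sv\<close>.\<close>
  have "\<forall>\<^sub>F \<epsilon> in at_right 0. \<forall>x. Z i \<epsilon> x = (1 / \<tau>) * (Sv \<epsilon> x - \<epsilon> * (\<epsilon> * V i \<epsilon> x))"
    using sys
  proof eventually_elim
    case (elim \<epsilon>)
    show ?case
    proof
      fix x
      have "\<epsilon>\<^sup>2 * V i \<epsilon> x + \<tau> * Z i \<epsilon> x = Sv \<epsilon> x"
        using elim unfolding stage_system_def Z_def by blast
      then show "Z i \<epsilon> x = (1 / \<tau>) * (Sv \<epsilon> x - \<epsilon> * (\<epsilon> * V i \<epsilon> x))"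
        using \<tau> by (simp add: field_simps power2_eq_square)
    qed
  qed
  moreover have "O_Ck L k 1 (\<lambda>\<epsilon> x. (1 / \<tau>) * (Sv \<epsilon> x - \<epsilon> * (\<epsilon> * V i \<epsilon> x)))"
    using UVW by (intro O_Ck_cmult O_Ck_diff O_Ck_mono[OF Sv] O_Ck_eps1 O_Ck_eps') auto
  ultimately have "O_Ck L k 1 (Z i)" by (simp add: O_Ck_cong)
  with UVW show ?thesis by (simp add: stage_bounded_def)
qed

lemma W_deriv_eq:
  assumes i: "i < s" and bd: "\<And>j. j \<le> i \<Longrightarrow> stage_bounded 2 j" and st: "start 1"
    and \<eta>: "Ck_periodic L 2 \<eta>"
  shows "\<forall>\<^sub>F \<epsilon> in at_right 0. \<forall>x. deriv (W i \<epsilon>) x = deriv (w0 \<epsilon>) x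
      - dt * (\<Sum>j<i. At $$ (i, j) * (\<delta>3 * (\<epsilon> * (\<epsilon> * deriv (deriv (W j \<epsilon>)) x))))
      - dt * (\<Sum>j\<le>i. A $$ (i, j) * ((1 - \<delta>3) * (\<epsilon> * (\<epsilon> * deriv (deriv (W j \<epsilon>)) x)) + deriv (V j \<epsilon>) x))"
proof -
  have "\<forall>\<^sub>F \<epsilon> in at_right 0. \<forall>j\<in>{..i}. Ck_periodic L 2 (V j \<epsilon>) \<and> Ck_periodic L 2 (W j \<epsilon>)"
    using bd by (intro eventually_ball_finite) (auto simp: stage_bounded_def eventually_conj_iff
        intro: O_Ck_imp_eventually_Ck)
  moreover have "\<forall>\<^sub>F \<epsilon> in at_right 0. Ck_periodic L 1 (w0 \<epsilon>)"
    using start_bounded[OF st] \<eta> by (auto intro: O_Ck_imp_eventually_Ck simp: numeral_2_eq_2)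
  ultimately show ?thesis
    using W_eq[OF i]
  proof eventually_elim
    case (elim \<epsilon>)
    note D = Ck2_DERIV[where L = L]
    have Dw: "(w0 \<epsilon> has_field_derivative deriv (w0 \<epsilon>) x) (at x)" for x
      using Ck_DERIV[OF elim(2)] by simp
    have W: "W i \<epsilon> = (\<lambda>x. w0 \<epsilon> x
      - dt * (\<Sum>j<i. At $$ (i, j) * (\<delta>3 * (\<epsilon> * (\<epsilon> * deriv (W j \<epsilon>) x))))
      - dt * (\<Sum>j\<le>i. A $$ (i, j) * ((1 - \<delta>3) * (\<epsilon> * (\<epsilon> * deriv (W j \<epsilon>) x)) + V j \<epsilon> x)))"
      using elim(3) by auto
    show ?case
      by (intro allI DERIV_imp_deriv, subst W)
        (intro DERIV_diff DERIV_cmult DERIV_sum DERIV_add D Dw; use elim(1) in auto)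
  qed
qed

text \<open>Expressing \<open>deriv (W i \<epsilon>)\<close> through \<open>Z i\<close> turns
  \<open>U i \<epsilon> x - deriv (W i \<epsilon>) x\<close> into (I - d_xx) U_i up to
  O(\<epsilon>), which can be compared with \<open>E_eq\<close>. Two of the three lost orders go
  into second derivatives, the third into passing from u to w.\<close>

lemma stage_close_step:
  assumes i: "i < s" and bd: "\<And>j. j \<le> i \<Longrightarrow> stage_bounded (k + 3) j"
    and cl: "\<And>j. j < i \<Longrightarrow> stage_close (k + 3) j"
    and st: "start (k + 3)" and \<eta>: "Ck_periodic L (k + 4) \<eta>"
    and E: "\<And>j. j \<le> i \<Longrightarrow> Ck_periodic L (k + 4) (E j)"
  shows "stage_close k i"
proof -
  have b: "O_Ck L (k + 3) 0 u0" "O_Ck L (k + 3) 0 w0"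
    using start_bounded[OF st] \<eta> by (auto simp: eval_nat_numeral)
  have st2: "O_Ck L (k + 1) 1 (\<lambda>\<epsilon> x. u0 \<epsilon> x - \<eta> x)"
    using st by (auto simp: start_def intro: O_Ck_mono)
  have "O_Ck L (k + 2) 1 (\<lambda>\<epsilon> x. deriv (w0 \<epsilon>) x - deriv (deriv \<eta>) x)"
    using st b \<eta> by (intro O_Ck_deriv_diff[where p = 0 and q = 0] O_Ck_const L Ck_deriv)
      (auto simp: start_def eval_nat_numeral)
  then have st3: "O_Ck L (k + 1) 1 (\<lambda>\<epsilon> x. deriv (w0 \<epsilon>) x - deriv (deriv \<eta>) x)"
    by (rule O_Ck_mono) auto
  have p: "O_Ck L (k + 3) 0 (U j)" "O_Ck L (k + 3) 0 (V j)" "O_Ck L (k + 3) 0 (W j)" "O_Ck L (k + 3) 1 (Z j)"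
    if "j \<le> i" for j using bd[OF that] by (auto simp: stage_bounded_def)
  have d: "O_Ck L (k + 1) 0 (\<lambda>\<epsilon>. deriv (F \<epsilon>))" "O_Ck L (k + 1) 0 (\<lambda>\<epsilon>. deriv (deriv (F \<epsilon>)))"
    if "O_Ck L (k + 3) 0 F" for F
    using O_Ck_deriv[of L "k + 2" 0 F] that O_Ck_deriv[of L "k + 1" 0 "\<lambda>\<epsilon>. deriv (F \<epsilon>)"]
    by (auto simp: eval_nat_numeral intro: O_Ck_mono)
  have dZ: "O_Ck L (k + 1) 1 (\<lambda>\<epsilon>. deriv (Z i \<epsilon>))"
    using O_Ck_deriv[of L "k + 2" 1 "Z i"] p(4)[of i] by (auto simp: eval_nat_numeral intro: O_Ck_mono)
  \<comment> \<open>The difference of the products \<open>u * u_x\<close> and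
    \<open>e * e_x\<close>, split so that each term contains one small factor.\<close>
  have quad: "O_Ck L (k + 1) 1 (\<lambda>\<epsilon> x. (U j \<epsilon> x - E j x) * deriv (U j \<epsilon>) x
      + E j x * (deriv (U j \<epsilon>) x - deriv (E j) x))" if "j < i" for j
  proof -
    have "O_Ck L (k + 2) 1 (\<lambda>\<epsilon> x. deriv (U j \<epsilon>) x - deriv (E j) x)"
      using cl[OF that] p(1)[of j] that E[of j]
      by (intro O_Ck_deriv_diff[where p = 0 and q = 0] O_Ck_const L)
        (auto simp: stage_close_def eval_nat_numeral intro: Ck_le)
    then have "O_Ck L (k + 1) 1 (\<lambda>\<epsilon> x. deriv (U j \<epsilon>) x - deriv (E j) x)"
      by (rule O_Ck_mono) auto
    moreover have "O_Ck L (k + 1) 1 (\<lambda>\<epsilon> x. U j \<epsilon> x - E j x)"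
      using cl[OF that] by (auto simp: stage_close_def intro: O_Ck_mono)
    moreover have "O_Ck L (k + 1) 0 (\<lambda>\<epsilon>. E j)"
      using E[of j] that by (intro O_Ck_const L) (auto intro: Ck_le)
    ultimately show ?thesis
      using O_Ck_mult[of L "k + 1" 1 _ 0] O_Ck_mult[of L "k + 1" 0 _ 1] d(1)[OF p(1)[of j]] that
      by (intro O_Ck_add) fastforce+
  qed
  define err where "err = (\<lambda>\<epsilon> x. U i \<epsilon> x - E i x)"
  \<comment> \<open>Order 0 is enough: \<open>O_Ck_helmholtz\<close> takes only regularity from this
    bound.\<close>
  have err_bdd: "O_Ck L (k + 1 + 2) 0 err"
    unfolding err_def using p(1)[of i] E[of i]
    by (intro O_Ck_diff O_Ck_const L) (auto simp: eval_nat_numeral intro: Ck_le)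
  \<comment> \<open>This is (I - d_xx) applied to \<open>err\<close>, sorted into terms of order
    \<epsilon>. The \<delta>1 sum over \<open>j \<le> i\<close> is the remainder of the implicit
    \<open>deriv V\<close> terms, with coefficient 1 - (1 - \<delta>1 * \<epsilon>).\<close>
  define rhs where "rhs = (\<lambda>\<epsilon> x. (u0 \<epsilon> x - \<eta> x) - (deriv (w0 \<epsilon>) x - deriv (deriv \<eta>) x)
      - dt * (\<Sum>j<i. At $$ (i, j) * ((U j \<epsilon> x - E j x) * deriv (U j \<epsilon>) x
          + E j x * (deriv (U j \<epsilon>) x - deriv (E j) x)))
      - dt * (\<Sum>j<i. At $$ (i, j) * (\<delta>1 * (\<epsilon> * deriv (V j \<epsilon>) x)))
      + dt * (\<Sum>j\<le>i. A $$ (i, j) * (\<delta>1 * (\<epsilon> * deriv (V j \<epsilon>) x)))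
      + dt * (\<Sum>j<i. At $$ (i, j) * (\<delta>3 * (\<epsilon> * (\<epsilon> * deriv (deriv (W j \<epsilon>)) x))))
      + dt * (\<Sum>j\<le>i. A $$ (i, j) * ((1 - \<delta>3) * (\<epsilon> * (\<epsilon> * deriv (deriv (W j \<epsilon>)) x))))
      - \<delta>2 * (\<epsilon> * deriv (deriv (U i \<epsilon>)) x) - deriv (Z i \<epsilon>) x)"
  have rhs: "O_Ck L (k + 1) 1 rhs"
    unfolding rhs_def
    by (intro O_Ck_diff[where G = "\<lambda>\<epsilon>. deriv (Z i \<epsilon>)"] O_Ck_diff[where G = "\<lambda>\<epsilon> x. \<delta>2 * _ \<epsilon> x"]
        O_Ck_diff[where F = "\<lambda>\<epsilon> x. (u0 \<epsilon> x - \<eta> x) - (deriv (w0 \<epsilon>) x - deriv (deriv \<eta>) x)"]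
        O_Ck_diff[OF st2 st3] O_Ck_diff[where G = "\<lambda>\<epsilon> x. dt * _ \<epsilon> x"]
        O_Ck_add[where G = "\<lambda>\<epsilon> x. dt * _ \<epsilon> x"] O_Ck_cmult O_Ck_sum quad dZ
        O_Ck_eps1 O_Ck_eps' d p) auto
  have "\<forall>\<^sub>F \<epsilon> in at_right 0. Ck_periodic L 2 (U i \<epsilon>) \<and> Ck_periodic L 1 (Z i \<epsilon>) "
    using p(1,4)[OF order_refl, THEN O_Ck_imp_eventually_Ck]
    by eventually_elim (auto intro: Ck_le)
  moreover have "\<forall>\<^sub>F \<epsilon> in at_right 0. \<forall>x. deriv (W i \<epsilon>) x = deriv (w0 \<epsilon>) x
      - dt * (\<Sum>j<i. At $$ (i, j) * (\<delta>3 * (\<epsilon> * (\<epsilon> * deriv (deriv (W j \<epsilon>)) x))))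
      - dt * (\<Sum>j\<le>i. A $$ (i, j) * ((1 - \<delta>3) * (\<epsilon> * (\<epsilon> * deriv (deriv (W j \<epsilon>)) x)) + deriv (V j \<epsilon>) x))"
    using st \<eta> by (intro W_deriv_eq i stage_bounded_mono[OF bd]) (auto intro: start_mono Ck_le)
  ultimately have "\<forall>\<^sub>F \<epsilon> in at_right 0. \<forall>x. rhs \<epsilon> x = err \<epsilon> x - deriv (deriv (err \<epsilon>)) x"
    using U_eq[OF i]
  proof eventually_elim
    case (elim \<epsilon>)
    note D = Ck2_DERIV[where L = L]
    have Ei: "Ck_periodic L 2 (E i)" using E[of i] by (auto intro: Ck_le)
    have C: "Ck_periodic L 2 (U i \<epsilon>)" "Ck_periodic L 1 (Z i \<epsilon>)" using elim(1) by auto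
    have err': "deriv (err \<epsilon>) = (\<lambda>x. deriv (U i \<epsilon>) x - deriv (E i) x)"
      unfolding err_def by (intro ext DERIV_imp_deriv DERIV_diff D C Ei)
    have err'': "deriv (deriv (err \<epsilon>)) = (\<lambda>x. deriv (deriv (U i \<epsilon>)) x - deriv (deriv (E i)) x)"
      unfolding err' by (intro ext DERIV_imp_deriv DERIV_diff D C Ei)
    have "W i \<epsilon> = (\<lambda>x. (1 - \<delta>2 * \<epsilon>) * deriv (U i \<epsilon>) x - Z i \<epsilon> x)"
      unfolding Z_def by auto
    then have W': "deriv (W i \<epsilon>) x = (1 - \<delta>2 * \<epsilon>) * deriv (deriv (U i \<epsilon>)) x - deriv (Z i \<epsilon>) x" for x
      using Ck_DERIV[OF C(2)] D(2)[OF C(1)]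
      by (auto intro!: DERIV_imp_deriv DERIV_diff DERIV_cmult)
    show ?case
    proof
      fix x
      show "rhs \<epsilon> x = err \<epsilon> x - deriv (deriv (err \<epsilon>)) x"
        using elim(2)[rule_format, of x] elim(3)[rule_format, of x] E_eq[OF i, of x] W'[of x]
        unfolding rhs_def err'' unfolding err_def
        by (simp add: algebra_simps sum.distrib sum_subtractf)
    qed
  qed
  from O_Ck_cong[OF this] rhs have "O_Ck L (k + 1) 1 (\<lambda>\<epsilon> x. err \<epsilon> x - deriv (deriv (err \<epsilon>)) x)"
    by simp
  from O_Ck_helmholtz[OF L err_bdd this] have err1: "O_Ck L (k + 1) 1 err" .
  then have "O_Ck L k 1 (\<lambda>\<epsilon> x. deriv (U i \<epsilon>) x - deriv (E i) x)"
    unfolding err_def using p(1)[of i] E[of i]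
    by (intro O_Ck_deriv_diff[where p = 0 and q = 0] O_Ck_const L) (auto intro: O_Ck_mono Ck_le)
  \<comment> \<open>This is \<open>W i \<epsilon> x - deriv (E i) x\<close> with \<open>W i\<close>
    expressed through \<open>Z i\<close>.\<close>
  then have "O_Ck L k 1 (\<lambda>\<epsilon> x. (deriv (U i \<epsilon>) x - deriv (E i) x) - \<delta>2 * (\<epsilon> * deriv (U i \<epsilon>) x) - Z i \<epsilon> x)"
    using O_Ck_mono[OF d(1)[OF p(1)[of i]], of k 0] p(4)[of i]
    by (intro O_Ck_diff[where G = "Z i"] O_Ck_diff[where G = "\<lambda>\<epsilon> x. \<delta>2 * _ \<epsilon> x"] O_Ck_cmult O_Ck_eps1)
      (auto intro: O_Ck_mono)
  then have "O_Ck L k 1 (\<lambda>\<epsilon> x. W i \<epsilon> x - deriv (E i) x)"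
    by (simp add: Z_def algebra_simps)
  with err1 show ?thesis unfolding stage_close_def err_def by (auto intro: O_Ck_mono)
qed

text \<open>A stage costs 3 orders for boundedness and 3 for closeness, so the induction hypothesis
  is used at \<open>k + 6\<close>. The claim covers all earlier stages, since each of them may enter
  the next one.\<close>

lemma stages_converge:
  "i \<le> s \<Longrightarrow> start (k + 6 * i) \<Longrightarrow> Ck_periodic L (k + 6 * i + 1) \<eta> \<Longrightarrow>
   (\<And>j. j < i \<Longrightarrow> Ck_periodic L (k + 6 * i + 1) (E j)) \<Longrightarrow> j < i \<Longrightarrow> stage_bounded k j \<and> stage_close k j"
proof (induction i arbitrary: k j)
  case (Suc i)
  have IH: "stage_bounded (k + 6) j \<and> stage_close (k + 6) j" if "j < i" for j
    using Suc.prems(1-4) that by (intro Suc.IH) (auto simp: algebra_simps)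
  have i: "i < s" using Suc.prems(1) by simp
  have bi: "stage_bounded (k + 3) i"
    by (rule stage_bounded_step[OF i])
      (use IH Suc.prems in \<open>auto simp: algebra_simps intro: Ck_le start_mono stage_bounded_mono\<close>)
  have b: "stage_bounded (k + 3) j" if "j \<le> i" for j
    using that bi IH[of j] stage_bounded_mono[of "k + 6" j "k + 3"] by (cases "j = i") auto
  have "stage_close (k + 3) j" if "j < i" for j
    using IH[OF that] stage_close_mono by auto
  moreover have "Ck_periodic L (k + 4) (E j)" if "j \<le> i" for j
    using Suc.prems(4)[of j] that by (auto intro: Ck_le)
  ultimately have "stage_close k i"
    using Suc.prems b by (intro stage_close_step[OF i]) (auto intro: Ck_le start_mono)
  then show ?case
    using b[of j] IH[of j] Suc.prems(5) stage_bounded_mono[of "k + 3" j k] stage_close_mono[of "k + 6" j k]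
    by (cases "j = i") auto
qed simp

section \<open>The limit of the v component\<close>

lemma V_combination:
  assumes i: "i < s" and bd: "\<And>j. j \<le> i \<Longrightarrow> stage_bounded (k + 1) j"
  shows "O_Ck L k 1 (\<lambda>\<epsilon> x. dt * (\<Sum>j\<le>i. A $$ (i, j) * V j \<epsilon> x) + (W i \<epsilon> x - w0 \<epsilon> x))"
proof -
  have d: "O_Ck L k 0 (\<lambda>\<epsilon>. deriv (W j \<epsilon>))" if "j \<le> i" for j
    using bd[OF that] by (auto simp: stage_bounded_def intro: O_Ck_deriv)
  \<comment> \<open>Besides the implicit sum of \<open>V\<close>, the increment of w contains only
    terms with the factor \<epsilon>^2; one order of it is recorded.\<close>
  have "O_Ck L k 1 (\<lambda>\<epsilon> x. (- dt) * (\<Sum>j<i. At $$ (i, j) * (\<delta>3 * (\<epsilon> * (\<epsilon> * deriv (W j \<epsilon>) x))))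
      + (- dt) * (\<Sum>j\<le>i. A $$ (i, j) * ((1 - \<delta>3) * (\<epsilon> * (\<epsilon> * deriv (W j \<epsilon>) x)))))"
    by (intro O_Ck_add O_Ck_cmult O_Ck_sum O_Ck_eps1 O_Ck_eps' d) auto
  moreover have "\<forall>\<^sub>F \<epsilon> in at_right 0. \<forall>x.
      dt * (\<Sum>j\<le>i. A $$ (i, j) * V j \<epsilon> x) + (W i \<epsilon> x - w0 \<epsilon> x) =
      (- dt) * (\<Sum>j<i. At $$ (i, j) * (\<delta>3 * (\<epsilon> * (\<epsilon> * deriv (W j \<epsilon>) x))))
      + (- dt) * (\<Sum>j\<le>i. A $$ (i, j) * ((1 - \<delta>3) * (\<epsilon> * (\<epsilon> * deriv (W j \<epsilon>) x))))"
    using W_eq[OF i] by eventually_elim (simp add: algebra_simps sum.distrib sum_subtractf)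
  ultimately show ?thesis by (simp add: O_Ck_cong)
qed

text \<open>\<open>\<beta>\<close> is the last row of the inverse of \<open>Ah\<close>; applied to
  the sums in \<open>V_combination\<close> it isolates the last stage. The ARS property removes
  column 0 and with it the old v, whose limit is not controlled.\<close>

lemma V_limit:
  fixes \<beta> :: "nat \<Rightarrow> real"
  assumes s: "2 \<le> s" and bd: "\<And>j. j < s \<Longrightarrow> stage_bounded (k + 1) j" and cl: "\<And>j. j < s \<Longrightarrow> stage_close k j"
    and st: "start k"
    and lower: "\<And>i j. i < s \<Longrightarrow> j < s \<Longrightarrow> i < j \<Longrightarrow> A $$ (i, j) = 0"
    and ars: "\<And>i. i < s \<Longrightarrow> A $$ (i, 0) = 0"
    and \<beta>: "\<And>c. c < s - 1 \<Longrightarrow> (\<Sum>r<s - 1. \<beta> r * A $$ (Suc r, Suc c)) = (if c = s - 2 then 1 else 0)"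
  shows "O_Ck L k 1 (\<lambda>\<epsilon> x. V (s - 1) \<epsilon> x - - (\<Sum>r<s - 1. \<beta> r * ((deriv (E (Suc r)) x - deriv \<eta> x) / dt)))"
proof -
  define Y where "Y r \<epsilon> x = (\<Sum>j\<le>Suc r. A $$ (Suc r, j) * V j \<epsilon> x)" for r \<epsilon> x
  have Y: "Y r \<epsilon> x = (\<Sum>c<s - 1. A $$ (Suc r, Suc c) * V (Suc c) \<epsilon> x)" if "r < s - 1" for r \<epsilon> x
  proof -
    have "Y r \<epsilon> x = (\<Sum>j<s. A $$ (Suc r, j) * V j \<epsilon> x)"
      unfolding Y_def using that lower by (intro sum.mono_neutral_left) auto
    also have "\<dots> = (\<Sum>j<Suc (s - 1). A $$ (Suc r, j) * V j \<epsilon> x)" using s by simp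
    also have "\<dots> = (\<Sum>c<s - 1. A $$ (Suc r, Suc c) * V (Suc c) \<epsilon> x)"
      unfolding sum.lessThan_Suc_shift using ars[of "Suc r"] that by simp
    finally show ?thesis .
  qed
  have V: "V (s - 1) \<epsilon> x = (\<Sum>r<s - 1. \<beta> r * Y r \<epsilon> x)" for \<epsilon> x
  proof -
    have "(\<Sum>r<s - 1. \<beta> r * Y r \<epsilon> x) = (\<Sum>r<s - 1. \<Sum>c<s - 1. (\<beta> r * A $$ (Suc r, Suc c)) * V (Suc c) \<epsilon> x)"
      by (intro sum.cong refl) (simp add: Y sum_distrib_left mult_ac)
    also have "\<dots> = (\<Sum>c<s - 1. (\<Sum>r<s - 1. \<beta> r * A $$ (Suc r, Suc c)) * V (Suc c) \<epsilon> x)"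
      by (subst sum.swap) (simp add: sum_distrib_right)
    also have "\<dots> = (\<Sum>c<s - 1. if c = s - 2 then V (Suc c) \<epsilon> x else 0)"
      by (intro sum.cong refl) (use \<beta> in auto)
    also have "\<dots> = V (s - 1) \<epsilon> x" using s by (simp add: Suc_diff_Suc numeral_2_eq_2)
    finally show ?thesis by simp
  qed
  \<comment> \<open>In each summand \<open>W\<close> and \<open>w0\<close> cancel, which leaves
    \<open>dt * Y r\<close> plus the BBM increment. The grouping shows three quantities of order
    \<epsilon>.\<close>
  have "O_Ck L k 1 (\<lambda>\<epsilon> x. \<Sum>r<s - 1. (\<beta> r / dt) *
      ((dt * Y r \<epsilon> x + (W (Suc r) \<epsilon> x - w0 \<epsilon> x)) - (W (Suc r) \<epsilon> x - deriv (E (Suc r)) x)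
       + (w0 \<epsilon> x - deriv \<eta> x)))"
  proof (intro O_Ck_sum O_Ck_cmult)
    fix r assume "r \<in> {..<s - 1}"
    then have r: "Suc r < s" by auto
    have 1: "O_Ck L k 1 (\<lambda>\<epsilon> x. dt * Y r \<epsilon> x + (W (Suc r) \<epsilon> x - w0 \<epsilon> x))"
      unfolding Y_def using r bd by (intro V_combination) auto
    have 2: "O_Ck L k 1 (\<lambda>\<epsilon> x. W (Suc r) \<epsilon> x - deriv (E (Suc r)) x)"
      "O_Ck L k 1 (\<lambda>\<epsilon> x. w0 \<epsilon> x - deriv \<eta> x)"
      using cl[OF r] st by (auto simp: stage_close_def start_def)
    show "O_Ck L k 1 (\<lambda>\<epsilon> x. (dt * Y r \<epsilon> x + (W (Suc r) \<epsilon> x - w0 \<epsilon> x))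
        - (W (Suc r) \<epsilon> x - deriv (E (Suc r)) x) + (w0 \<epsilon> x - deriv \<eta> x))"
      by (rule O_Ck_add[OF O_Ck_diff[OF 1 2(1)] 2(2)])
  qed
  also have "(\<lambda>\<epsilon> x. \<Sum>r<s - 1. (\<beta> r / dt) *
      ((dt * Y r \<epsilon> x + (W (Suc r) \<epsilon> x - w0 \<epsilon> x)) - (W (Suc r) \<epsilon> x - deriv (E (Suc r)) x)
       + (w0 \<epsilon> x - deriv \<eta> x))) =
    (\<lambda>\<epsilon> x. V (s - 1) \<epsilon> x - - (\<Sum>r<s - 1. \<beta> r * ((deriv (E (Suc r)) x - deriv \<eta> x) / dt)))"
    using dt unfolding V by (intro ext) (simp add: field_simps flip: sum.distrib)
  finally show ?thesis .
qed

lemma step_convergence: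
  assumes "start (k + 6 * s)" "Ck_periodic L (k + 6 * s + 1) \<eta>"
    and "\<And>j. j < s \<Longrightarrow> Ck_periodic L (k + 6 * s + 1) (E j)" and "j < s"
  shows "O_Ck L k 1 (\<lambda>\<epsilon> x. U j \<epsilon> x - E j x)" "O_Ck L k 0 (V j)"
    "O_Ck L k 1 (\<lambda>\<epsilon> x. W j \<epsilon> x - deriv (E j) x)"
  using stages_converge[of s k j] assms by (auto simp: stage_bounded_def stage_close_def)

text \<open>One order more than in \<open>step_convergence\<close> is spent on the
  \<open>deriv W\<close> terms of \<open>V_combination\<close>.\<close>

lemma step_convergence_ARS:
  fixes \<beta> :: "nat \<Rightarrow> real"
  assumes s: "2 \<le> s" and st: "start (k + 1 + 6 * s)" and C: "Ck_periodic L (k + 1 + 6 * s + 1) \<eta>"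
    "\<And>j. j < s \<Longrightarrow> Ck_periodic L (k + 1 + 6 * s + 1) (E j)"
    and lower: "\<And>i j. i < s \<Longrightarrow> j < s \<Longrightarrow> i < j \<Longrightarrow> A $$ (i, j) = 0"
    and ars: "\<And>i. i < s \<Longrightarrow> A $$ (i, 0) = 0"
    and \<beta>: "\<And>c. c < s - 1 \<Longrightarrow> (\<Sum>r<s - 1. \<beta> r * A $$ (Suc r, Suc c)) = (if c = s - 2 then 1 else 0)"
  shows "O_Ck L k 1 (\<lambda>\<epsilon> x. V (s - 1) \<epsilon> x - - (\<Sum>r<s - 1. \<beta> r * ((deriv (E (Suc r)) x - deriv \<eta> x) / dt)))"
proof -
  have stages: "stage_bounded (k + 1) j \<and> stage_close (k + 1) j" if "j < s" for j
    by (rule stages_converge[OF order_refl st C that])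
  show ?thesis
    using stages stage_close_mono[of "k + 1" _ k] start_mono[OF st, of k]
    by (intro V_limit s lower ars \<beta>) auto
qed

end

section \<open>The asymptotic preserving property\<close>

lemma bbmh_stage_equations:
  assumes step: "imex_step (bbmh_f \<delta>1 \<delta>2 \<delta>3 \<epsilon>) (bbmh_g \<delta>1 \<delta>2 \<delta>3 \<epsilon>) s At bt A b dt q0 Q q1"
    and i: "i < s" and \<epsilon>: "\<epsilon> > 0"
  shows "u_of (Q i) x = u_of q0 x
      - dt * (\<Sum>j<i. At $$ (i, j) * (u_of (Q j) x * deriv (u_of (Q j)) x + \<delta>1 * (\<epsilon> * deriv (v_of (Q j)) x)))
      - dt * (\<Sum>j\<le>i. A $$ (i, j) * ((1 - \<delta>1 * \<epsilon>) * deriv (v_of (Q j)) x))" (is ?u)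
    and "\<epsilon>\<^sup>2 * v_of (Q i) x = \<epsilon>\<^sup>2 * v_of q0 x
      - dt * (\<Sum>j<i. At $$ (i, j) * (\<delta>2 * (\<epsilon> * deriv (u_of (Q j)) x)))
      - dt * (\<Sum>j\<le>i. A $$ (i, j) * ((1 - \<delta>2 * \<epsilon>) * deriv (u_of (Q j)) x - w_of (Q j) x))" (is ?v)
    and "w_of (Q i) x = w_of q0 x
      - dt * (\<Sum>j<i. At $$ (i, j) * (\<delta>3 * (\<epsilon> * (\<epsilon> * deriv (w_of (Q j)) x))))
      - dt * (\<Sum>j\<le>i. A $$ (i, j) * ((1 - \<delta>3) * (\<epsilon> * (\<epsilon> * deriv (w_of (Q j)) x)) + v_of (Q j) x))" (is ?w)
proof -
  have eq: "Q i x = q0 x + dt *\<^sub>R (\<Sum>j<i. At $$ (i, j) *\<^sub>R bbmh_f \<delta>1 \<delta>2 \<delta>3 \<epsilon> (Q j) x)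
      + dt *\<^sub>R (\<Sum>j\<le>i. A $$ (i, j) *\<^sub>R bbmh_g \<delta>1 \<delta>2 \<delta>3 \<epsilon> (Q j) x)"
    using step i by (simp add: imex_step_def)
  have f: "fst (bbmh_f \<delta>1 \<delta>2 \<delta>3 \<epsilon> q x) = - (u_of q x * deriv (u_of q) x + \<delta>1 * \<epsilon> * deriv (v_of q) x)"
    "fst (snd (bbmh_f \<delta>1 \<delta>2 \<delta>3 \<epsilon> q x)) = - (\<delta>2 / \<epsilon> * deriv (u_of q) x)"
    "snd (snd (bbmh_f \<delta>1 \<delta>2 \<delta>3 \<epsilon> q x)) = - (\<delta>3 * \<epsilon>\<^sup>2 * deriv (w_of q) x)"
    "fst (bbmh_g \<delta>1 \<delta>2 \<delta>3 \<epsilon> q x) = - ((1 - \<delta>1 * \<epsilon>) * deriv (v_of q) x)"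
    "fst (snd (bbmh_g \<delta>1 \<delta>2 \<delta>3 \<epsilon> q x)) =
       - ((1 - \<delta>2 * \<epsilon>) / \<epsilon>\<^sup>2 * deriv (u_of q) x - 1 / \<epsilon>\<^sup>2 * w_of q x)"
    "snd (snd (bbmh_g \<delta>1 \<delta>2 \<delta>3 \<epsilon> q x)) = - ((1 - \<delta>3) * \<epsilon>\<^sup>2 * deriv (w_of q) x + v_of q x)" for q
    by (simp_all add: bbmh_f_def bbmh_g_def Let_def)
  have m: "dt * (\<Sum>j\<in>I. a j * - X j) = - (dt * (\<Sum>j\<in>I. a j * X j))"
    for a X :: "nat \<Rightarrow> real" and I by (simp add: sum_negf)
  show ?u
    using arg_cong[OF eq, of fst]
    unfolding fst_add fst_scaleR fst_sum f real_scaleR_def m by (simp add: u_of_def mult.assoc)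
  show ?w
    using arg_cong[OF eq, of "\<lambda>q. snd (snd q)"]
    unfolding snd_add snd_scaleR snd_sum f real_scaleR_def m
    by (simp add: w_of_def mult.assoc power2_eq_square)
  have sc: "\<epsilon>\<^sup>2 * (dt * (\<Sum>j\<in>I. a j * X j)) = dt * (\<Sum>j\<in>I. a j * (\<epsilon>\<^sup>2 * X j))"
    for a X :: "nat \<Rightarrow> real" and I by (simp add: sum_distrib_left mult_ac)
  have e: "\<epsilon>\<^sup>2 * (\<delta>2 / \<epsilon> * D) = \<delta>2 * (\<epsilon> * D)"
    "\<epsilon>\<^sup>2 * ((1 - \<delta>2 * \<epsilon>) / \<epsilon>\<^sup>2 * D - 1 / \<epsilon>\<^sup>2 * w) = (1 - \<delta>2 * \<epsilon>) * D - w" for D w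
    using \<epsilon> by (simp_all add: field_simps power2_eq_square)
  have "v_of (Q i) x = v_of q0 x
      - dt * (\<Sum>j<i. At $$ (i, j) * (\<delta>2 / \<epsilon> * deriv (u_of (Q j)) x))
      - dt * (\<Sum>j\<le>i. A $$ (i, j) * ((1 - \<delta>2 * \<epsilon>) / \<epsilon>\<^sup>2 * deriv (u_of (Q j)) x - 1 / \<epsilon>\<^sup>2 * w_of (Q j) x))"
    using arg_cong[OF eq, of "\<lambda>q. fst (snd q)"]
    unfolding fst_add snd_add fst_scaleR snd_scaleR fst_sum snd_sum f real_scaleR_def m
    by (simp add: v_of_def)
  then have "\<epsilon>\<^sup>2 * v_of (Q i) x = \<epsilon>\<^sup>2 * v_of q0 x
      - \<epsilon>\<^sup>2 * (dt * (\<Sum>j<i. At $$ (i, j) * (\<delta>2 / \<epsilon> * deriv (u_of (Q j)) x)))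
      - \<epsilon>\<^sup>2 * (dt * (\<Sum>j\<le>i. A $$ (i, j) * ((1 - \<delta>2 * \<epsilon>) / \<epsilon>\<^sup>2 * deriv (u_of (Q j)) x - 1 / \<epsilon>\<^sup>2 * w_of (Q j) x)))"
    by (simp only: right_diff_distrib)
  then show ?v unfolding sc e .
qed

section \<open>Stiff accuracy and regularity of the BBM scheme\<close>

lemma imex_step_gsa:
  assumes step: "imex_step f g s At bt A b dt q0 Q q1"
    and gsa: "globally_stiffly_accurate s At bt A b" and At: "At $$ (s - 1, s - 1) = 0" and s: "0 < s"
  shows "q1 = Q (s - 1)"
proof
  fix x
  obtain r where r: "s = Suc r" using s gr0_implies_Suc by blast
  have "q1 x = q0 x + dt *\<^sub>R (\<Sum>i<s. bt $ i *\<^sub>R f (Q i) x) + dt *\<^sub>R (\<Sum>i<s. b $ i *\<^sub>R g (Q i) x)"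
    and Q: "Q (s - 1) x = q0 x + dt *\<^sub>R (\<Sum>j<s - 1. At $$ (s - 1, j) *\<^sub>R f (Q j) x)
      + dt *\<^sub>R (\<Sum>j\<le>s - 1. A $$ (s - 1, j) *\<^sub>R g (Q j) x)"
    using step s by (auto simp: imex_step_def)
  \<comment> \<open>The sum over the weights has one more term than the stage, with index
    \<open>s - 1\<close>; its weight is the diagonal entry of \<open>At\<close>, which is 0.\<close>
  moreover have "(\<Sum>i<s. bt $ i *\<^sub>R f (Q i) x) = (\<Sum>j<s - 1. At $$ (s - 1, j) *\<^sub>R f (Q j) x)"
    using gsa At by (auto simp: globally_stiffly_accurate_def r intro!: sum.cong)
  moreover have "(\<Sum>i<s. b $ i *\<^sub>R g (Q i) x) = (\<Sum>j\<le>s - 1. A $$ (s - 1, j) *\<^sub>R g (Q j) x)"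
    using gsa by (auto simp: globally_stiffly_accurate_def r lessThan_Suc_atMost intro!: sum.cong)
  ultimately show "q1 x = Q (s - 1) x" by simp
qed

lemma bbm_step_facts:
  assumes L: "L > 0" and dt: "dt \<noteq> 0" and s: "0 < s" and sol: "bbm_numerical_solution L s At bt dt N \<eta> E"
    and gsa: "globally_stiffly_accurate s At bt A b" and At: "At $$ (s - 1, s - 1) = 0" and n: "n < N"
  shows "\<And>i x. i < s \<Longrightarrow> E n i x - deriv (deriv (E n i)) x = \<eta> n x - deriv (deriv (\<eta> n)) x
      - dt * (\<Sum>j<i. At $$ (i, j) * (E n j x * deriv (E n j) x))"
    and "\<eta> (Suc n) = E n (s - 1)"
proof -
  have C: "Ck_periodic L 2 (\<eta> n)" "Ck_periodic L 2 (\<eta> (Suc n))" "\<And>i. i < s \<Longrightarrow> Ck_periodic L 2 (E n i)"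
    using sol n by (auto simp: bbm_numerical_solution_def)
  show E: "E n i x - deriv (deriv (E n i)) x = \<eta> n x - deriv (deriv (\<eta> n)) x
      - dt * (\<Sum>j<i. At $$ (i, j) * (E n j x * deriv (E n j) x))" if "i < s" for i x
    using sol n that by (intro bbm_increment[where L = L] dt C) (auto simp: bbm_numerical_solution_def)
  have "\<eta> (Suc n) x - deriv (deriv (\<eta> (Suc n))) x = \<eta> n x - deriv (deriv (\<eta> n)) x
      - dt * (\<Sum>i<s. bt $ i * (E n i x * deriv (E n i) x))" for x
    using sol n by (intro bbm_increment[where L = L] dt C) (auto simp: bbm_numerical_solution_def)
  moreover have "(\<Sum>i<s. bt $ i * (E n i x * deriv (E n i) x)) =
      (\<Sum>j<s - 1. At $$ (s - 1, j) * (E n j x * deriv (E n j) x))" for x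
  proof -
    obtain r where "s = Suc r" using s gr0_implies_Suc by blast
    then show ?thesis
      using gsa At by (auto simp: globally_stiffly_accurate_def intro!: sum.cong)
  qed
  ultimately show "\<eta> (Suc n) = E n (s - 1)"
    using s C E[of "s - 1"] by (intro helmholtz_unique[OF L]) auto
qed

text \<open>The definition of the scheme provides C^2 only. The regularity of the initial datum
  passes to the stages of a step and, by \<open>bbm_step_facts\<close>, from the last stage to the
  next step.\<close>

lemma bbm_Ck:
  assumes L: "L > 0" and dt: "dt \<noteq> 0" and s: "0 < s" and sol: "bbm_numerical_solution L s At bt dt N \<eta> E"
    and gsa: "globally_stiffly_accurate s At bt A b" and At: "At $$ (s - 1, s - 1) = 0"
    and \<eta>0: "Ck_periodic L (Suc (Suc k)) (\<eta> 0)"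
  shows "n \<le> N \<Longrightarrow> Ck_periodic L (Suc (Suc k)) (\<eta> n)"
    and "n < N \<Longrightarrow> i < s \<Longrightarrow> Ck_periodic L (Suc (Suc k)) (E n i)"
proof -
  have E: "Ck_periodic L (Suc (Suc k)) (E n i)"
    if "n < N" "i < s" "Ck_periodic L (Suc (Suc k)) (\<eta> n)" for n i
    using that(2)
  proof (induction i rule: less_induct)
    case (less i)
    show ?case
    proof (rule Ck_bbm_stage[OF L _ that(3)])
      show "Ck_periodic L 2 (E n i)"
        using sol that less by (auto simp: bbm_numerical_solution_def)
      show "Ck_periodic L (Suc (Suc k)) (E n j)" if "j < i" for j using less that by auto
    qed (rule bbm_step_facts(1)[OF L dt s sol gsa At that(1) less.prems])
  qed
  show \<eta>: "Ck_periodic L (Suc (Suc k)) (\<eta> n)" if "n \<le> N" for n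
    using that
  proof (induction n)
    case (Suc n)
    then show ?case using bbm_step_facts(2)[OF L dt s sol gsa At, of n] E[of n "s - 1"] s by simp
  qed (rule \<eta>0)
  show "Ck_periodic L (Suc (Suc k)) (E n i)" if "n < N" "i < s"
    using E[OF that] \<eta>[of n] that by simp
qed

text \<open>\<open>Ah\<close> has size \<open>s - 1\<close>, so the row belonging to the last stage
  has index \<open>s - 2\<close>.\<close>

lemma discrete_dt_eq_sum:
  assumes "the (mat_inverse Ah) \<in> carrier_mat (s - 1) (s - 1)" "2 \<le> s"
  shows "discrete_dt s Ah dt e0 e x =
    (\<Sum>r<s - 1. the (mat_inverse Ah) $$ (s - 2, r) * ((e (Suc r) x - e0 x) / dt))"
  using assms unfolding discrete_dt_def by (simp add: scalar_prod_def atLeast0LessThan)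

text \<open>"Sufficiently smooth" is made precise by a \<open>K\<close> fixed before the data; its
  witness depends on \<open>m\<close>, \<open>n\<close> and \<open>s\<close> alone. As the initial v
  may vary with \<epsilon>, its bounds are required uniformly in \<epsilon>.\<close>

theorem theorem4p7:
  fixes \<delta>1 \<delta>2 \<delta>3 L dt \<beta>h :: real and s n m :: nat
    and At A Ah :: "real mat" and bt b \<alpha>h bh :: "real vec"
  assumes "\<delta>1 \<in> {0..1}" and "\<delta>2 \<in> {0..1}" and "\<delta>3 \<in> {0..1}"
    and "L > 0" and "dt > 0" and "n \<ge> 1"
    and "dirk_imex_tableau s At bt A b"
    and "type_II s A b \<alpha>h Ah \<beta>h bh"
    and "globally_stiffly_accurate s At bt A b"
  shows "\<exists>K. \<forall>(\<eta> :: nat \<Rightarrow> real \<Rightarrow> real) (E :: nat \<Rightarrow> nat \<Rightarrow> real \<Rightarrow> real)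
             (v0 :: real \<Rightarrow> real \<Rightarrow> real) (q :: real \<Rightarrow> nat \<Rightarrow> state).
           bbm_numerical_solution L s At bt dt n \<eta> E \<and>
           Ck_periodic L K (\<eta> 0) \<and>
           (\<forall>\<^sub>F \<epsilon> in at_right 0. Ck_periodic L K (v0 \<epsilon>)) \<and>
           (\<exists>C. \<forall>\<^sub>F \<epsilon> in at_right 0. \<forall>j\<le>K. \<forall>x. \<bar>(deriv ^^ j) (v0 \<epsilon>) x\<bar> \<le> C) \<and>
           (\<forall>\<^sub>F \<epsilon> in at_right 0.
              bbmh_numerical_solution \<delta>1 \<delta>2 \<delta>3 L s At bt A b dt \<epsilon> n (q \<epsilon>) \<and>
              u_of (q \<epsilon> 0) = \<eta> 0 \<and> v_of (q \<epsilon> 0) = v0 \<epsilon> \<and> w_of (q \<epsilon> 0) = deriv (\<eta> 0))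
           \<longrightarrow>
           Cm_limit L m (\<lambda>\<epsilon>. u_of (q \<epsilon> n)) (\<eta> n) \<and>
           Cm_limit L m (\<lambda>\<epsilon>. w_of (q \<epsilon> n)) (deriv (\<eta> n)) \<and>
           (ARS_property s \<alpha>h \<beta>h \<longrightarrow>
              Cm_limit L m (\<lambda>\<epsilon>. v_of (q \<epsilon> n))
                (\<lambda>x. - discrete_dt s Ah dt (deriv (\<eta> (n - 1))) (\<lambda>i. deriv (E (n - 1) i)) x))"
proof -
  note L = assms(4) and dt = assms(5) and tableau = assms(7) and II = assms(8) and gsa = assms(9)
  note entries = type_II_entries[OF tableau II]
  have s: "2 \<le> s" and Ah: "Ah \<in> carrier_mat (s - 1) (s - 1)" and inv: "invertible_mat Ah"
    using II by (auto simp: type_II_def)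
  have At: "At $$ (s - 1, s - 1) = 0" using tableau s by (auto simp: dirk_imex_tableau_def)
  note inverse = mat_inverse_left_inverse[OF Ah inv]
  \<comment> \<open>Each of the \<open>n\<close> steps uses up \<open>6 * s\<close> orders. The
    final 3 cover the extra order of the ARS part and the derivative of \<eta> in the
    invariant.\<close>
  define K where "K = m + 6 * s * n + 3"
  show ?thesis
  proof (intro exI[of _ K] allI impI, elim conjE exE)
    fix \<eta> :: "nat \<Rightarrow> real \<Rightarrow> real" and E :: "nat \<Rightarrow> nat \<Rightarrow> real \<Rightarrow> real"
      and v0 :: "real \<Rightarrow> real \<Rightarrow> real" and q :: "real \<Rightarrow> nat \<Rightarrow> state" and C
    assume bbm: "bbm_numerical_solution L s At bt dt n \<eta> E"
      and \<eta>0: "Ck_periodic L K (\<eta> 0)"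
      and v0: "\<forall>\<^sub>F \<epsilon> in at_right 0. Ck_periodic L K (v0 \<epsilon>)"
        "\<forall>\<^sub>F \<epsilon> in at_right 0. \<forall>j\<le>K. \<forall>x. \<bar>(deriv ^^ j) (v0 \<epsilon>) x\<bar> \<le> C"
      and sol: "\<forall>\<^sub>F \<epsilon> in at_right 0.
        bbmh_numerical_solution \<delta>1 \<delta>2 \<delta>3 L s At bt A b dt \<epsilon> n (q \<epsilon>) \<and>
        u_of (q \<epsilon> 0) = \<eta> 0 \<and> v_of (q \<epsilon> 0) = v0 \<epsilon> \<and> w_of (q \<epsilon> 0) = deriv (\<eta> 0)"
    have K: "K = Suc (Suc (K - 2))" by (simp add: K_def)
    have dt0: "dt \<noteq> 0" and s0: "0 < s" using dt s by auto
    have C\<eta>: "Ck_periodic L K (\<eta> l)" if "l \<le> n" for l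
      using bbm_Ck(1)[OF L dt0 s0 bbm gsa At, of "K - 2"] K \<eta>0 that by simp
    have CE: "Ck_periodic L K (E l i)" if "l < n" "i < s" for l i
      using bbm_Ck(2)[OF L dt0 s0 bbm gsa At, of "K - 2"] K \<eta>0 that by simp
    define is_stages where "is_stages \<epsilon> l Q \<longleftrightarrow>
        (\<forall>i<s. Ck_periodic L 1 (u_of (Q i)) \<and> Ck_periodic L 1 (v_of (Q i)) \<and> Ck_periodic L 1 (w_of (Q i))) \<and>
        imex_step (bbmh_f \<delta>1 \<delta>2 \<delta>3 \<epsilon>) (bbmh_g \<delta>1 \<delta>2 \<delta>3 \<epsilon>) s At bt A b dt (q \<epsilon> l) Q (q \<epsilon> (Suc l))"
      for \<epsilon> l Q
    \<comment> \<open>Stages are given by an existential for each \<epsilon> and each step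
      separately; choice assembles them into families in \<epsilon>.\<close>
    define Q where "Q \<epsilon> l = (SOME P. is_stages \<epsilon> l P)" for \<epsilon> l
    have Q: "\<forall>\<^sub>F \<epsilon> in at_right 0. is_stages \<epsilon> l (Q \<epsilon> l) \<and> 0 < \<epsilon>" if "l < n" for l
      using sol at_right_0_small[of 1, simplified]
    proof eventually_elim
      case (elim \<epsilon>)
      then have "\<exists>P. is_stages \<epsilon> l P"
        using that by (auto simp: bbmh_numerical_solution_def is_stages_def)
      with elim show ?case unfolding Q_def using someI_ex[of "is_stages \<epsilon> l"] by blast
    qed
    have family: "imex_bbmh_family \<delta>1 \<delta>2 \<delta>3 L dt s At A (\<lambda>\<epsilon>. u_of (q \<epsilon> l)) (\<lambda>\<epsilon>. v_of (q \<epsilon> l))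
        (\<lambda>\<epsilon>. w_of (q \<epsilon> l)) (\<lambda>i \<epsilon>. u_of (Q \<epsilon> l i)) (\<lambda>i \<epsilon>. v_of (Q \<epsilon> l i)) (\<lambda>i \<epsilon>. w_of (Q \<epsilon> l i)) (\<eta> l) (E l)"
      if l: "l < n" for l
    proof
      fix i assume i: "i < s"
      show "\<forall>\<^sub>F \<epsilon> in at_right 0. Ck_periodic L 1 (u_of (Q \<epsilon> l i)) \<and> Ck_periodic L 1 (v_of (Q \<epsilon> l i)) \<and>
          Ck_periodic L 1 (w_of (Q \<epsilon> l i))"
        using Q[OF l] by eventually_elim (use i in \<open>auto simp: is_stages_def\<close>)
      note step = bbmh_stage_equations[OF _ i]
      show "\<forall>\<^sub>F \<epsilon> in at_right 0. \<forall>x. u_of (Q \<epsilon> l i) x = u_of (q \<epsilon> l) x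
          - dt * (\<Sum>j<i. At $$ (i, j) * (u_of (Q \<epsilon> l j) x * deriv (u_of (Q \<epsilon> l j)) x
              + \<delta>1 * (\<epsilon> * deriv (v_of (Q \<epsilon> l j)) x)))
          - dt * (\<Sum>j\<le>i. A $$ (i, j) * ((1 - \<delta>1 * \<epsilon>) * deriv (v_of (Q \<epsilon> l j)) x))"
        using Q[OF l] by eventually_elim (use step(1) is_stages_def in blast)
      show "\<forall>\<^sub>F \<epsilon> in at_right 0. \<forall>x. \<epsilon>\<^sup>2 * v_of (Q \<epsilon> l i) x = \<epsilon>\<^sup>2 * v_of (q \<epsilon> l) x
          - dt * (\<Sum>j<i. At $$ (i, j) * (\<delta>2 * (\<epsilon> * deriv (u_of (Q \<epsilon> l j)) x)))
          - dt * (\<Sum>j\<le>i. A $$ (i, j) * ((1 - \<delta>2 * \<epsilon>) * deriv (u_of (Q \<epsilon> l j)) x - w_of (Q \<epsilon> l j) x))"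
        using Q[OF l] by eventually_elim (use step(2) is_stages_def in blast)
      show "\<forall>\<^sub>F \<epsilon> in at_right 0. \<forall>x. w_of (Q \<epsilon> l i) x = w_of (q \<epsilon> l) x
          - dt * (\<Sum>j<i. At $$ (i, j) * (\<delta>3 * (\<epsilon> * (\<epsilon> * deriv (w_of (Q \<epsilon> l j)) x))))
          - dt * (\<Sum>j\<le>i. A $$ (i, j) * ((1 - \<delta>3) * (\<epsilon> * (\<epsilon> * deriv (w_of (Q \<epsilon> l j)) x)) + v_of (Q \<epsilon> l j) x))"
        using Q[OF l] by eventually_elim (use step(3) is_stages_def in blast)
    qed (use assms(1-3) L dt entries(1,4) bbm_step_facts(1)[OF L dt0 s0 bbm gsa At l] in auto)
    define start where "start l k \<longleftrightarrow> O_Ck L k 1 (\<lambda>\<epsilon> x. u_of (q \<epsilon> l) x - \<eta> l x) \<and>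
        O_Ck L k 0 (\<lambda>\<epsilon>. v_of (q \<epsilon> l)) \<and> O_Ck L k 1 (\<lambda>\<epsilon> x. w_of (q \<epsilon> l) x - deriv (\<eta> l) x)" for l k
    have last: "\<forall>\<^sub>F \<epsilon> in at_right 0. q \<epsilon> (Suc l) = Q \<epsilon> l (s - 1)" if "l < n" for l
      using Q[OF that] by eventually_elim (use imex_step_gsa[OF _ gsa At s0] is_stages_def in blast)
    have advance: "start (Suc l) k" if l: "l < n" and st: "start l (k + 6 * s)" and k: "k + 6 * s + 1 \<le> K"
      for l k
    proof -
      note conv = imex_bbmh_family.step_convergence[OF family[OF l], unfolded imex_bbmh_family.start_def[OF family[OF l]],
          OF st[unfolded start_def] Ck_le[OF C\<eta> k] Ck_le[OF CE k], of "s - 1"]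
      have \<eta>: "\<eta> (Suc l) = E l (s - 1)" by (rule bbm_step_facts(2)[OF L dt0 s0 bbm gsa At l])
      have cong: "O_Ck L k p (\<lambda>\<epsilon> x. h (q \<epsilon> (Suc l)) x) \<longleftrightarrow> O_Ck L k p (\<lambda>\<epsilon> x. h (Q \<epsilon> l (s - 1)) x)"
        for h :: "state \<Rightarrow> real \<Rightarrow> real" and p
        by (rule O_Ck_cong) (use last[OF l] in \<open>eventually_elim, simp\<close>)
      show ?thesis
        unfolding start_def \<eta>
        using conv l s0 cong[of 1 "\<lambda>r x. u_of r x - E l (s - 1) x"] cong[of 0 v_of]
          cong[of 1 "\<lambda>r x. w_of r x - deriv (E l (s - 1)) x"]
        by simp
    qed
    \<comment> \<open>The remaining budget of derivatives: \<open>6 * s\<close> for each step still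
      to come, and \<open>m + 1\<close> in the end.\<close>
    have "start l (m + 1 + 6 * s * (n - l))" if "l \<le> n" for l
      using that
    proof (induction l)
      case 0
      have "O_Ck L K 0 v0"
        unfolding O_Ck_def using v0
        by (intro exI[of _ C]) (auto simp: Ck_bounded_def eventually_conj_iff elim: eventually_elim2)
      moreover have "\<forall>\<^sub>F \<epsilon> in at_right 0. \<forall>x. v0 \<epsilon> x = v_of (q \<epsilon> 0) x"
        using sol by eventually_elim simp
      ultimately have v: "O_Ck L K 0 (\<lambda>\<epsilon>. v_of (q \<epsilon> 0))" by (simp add: O_Ck_cong)
      \<comment> \<open>Well-prepared data: for small \<epsilon> both initial errors vanish
        identically.\<close>
      have u: "\<forall>\<^sub>F \<epsilon> in at_right 0. \<forall>x. u_of (q \<epsilon> 0) x - \<eta> 0 x = 0"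
        "\<forall>\<^sub>F \<epsilon> in at_right 0. \<forall>x. w_of (q \<epsilon> 0) x - deriv (\<eta> 0) x = 0"
        using sol by (auto elim!: eventually_mono)
      show ?case
        unfolding start_def O_Ck_cong[OF u(1)] O_Ck_cong[OF u(2)]
        using O_Ck_mono[OF v] by (auto simp: K_def O_Ck_zero)
    next
      case (Suc l)
      have "6 * s * (n - l) = 6 * s * (n - Suc l) + 6 * s"
        using Suc.prems by (simp add: Suc_diff_Suc[symmetric] algebra_simps)
      moreover have "6 * s * (n - l) \<le> 6 * s * n" by simp
      ultimately show ?case
        using Suc by (intro advance) (auto simp: K_def algebra_simps)
    qed
    from this[of n] this[of "n - 1"] have start_n: "start n (m + 1)" and start_last: "start (n - 1) (m + 1 + 6 * s)"
      using \<open>n \<ge> 1\<close> by auto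
    have le: "m + 1 + 6 * s + 1 \<le> K"
      using \<open>n \<ge> 1\<close> by (cases n) (auto simp: K_def)
    have dC: "Ck_periodic L m (deriv f)" if "Ck_periodic L K f" for f
      using Ck_le[OF Ck_deriv, of L "m + 6 * s * n + 2" f m] that by (simp add: K_def eval_nat_numeral)
    have u: "Cm_limit L m (\<lambda>\<epsilon>. u_of (q \<epsilon> n)) (\<eta> n)"
      using start_n C\<eta>[of n] by (intro O_Ck_imp_Cm_limit L)
        (auto simp: start_def K_def intro: O_Ck_mono Ck_le)
    have w: "Cm_limit L m (\<lambda>\<epsilon>. w_of (q \<epsilon> n)) (deriv (\<eta> n))"
      using start_n C\<eta>[of n] by (intro O_Ck_imp_Cm_limit L dC)
        (auto simp: start_def intro: O_Ck_mono)
    have v: "Cm_limit L m (\<lambda>\<epsilon>. v_of (q \<epsilon> n))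
        (\<lambda>x. - discrete_dt s Ah dt (deriv (\<eta> (n - 1))) (\<lambda>i. deriv (E (n - 1) i)) x)"
      if "ARS_property s \<alpha>h \<beta>h"
    proof (rule O_Ck_imp_Cm_limit[OF L])
      have l: "n - 1 < n" "Suc (n - 1) = n" using \<open>n \<ge> 1\<close> by auto
      define \<beta> where "\<beta> r = the (mat_inverse Ah) $$ (s - 2, r)" for r
      note D = discrete_dt_eq_sum[OF inverse(2) s, folded \<beta>_def]
      have \<beta>: "(\<Sum>r<s - 1. \<beta> r * A $$ (Suc r, Suc c)) = (if c = s - 2 then 1 else 0)" if c: "c < s - 1" for c
      proof -
        have "(\<Sum>r<s - 1. \<beta> r * A $$ (Suc r, Suc c)) = (the (mat_inverse Ah) * Ah) $$ (s - 2, c)"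
          using inverse(2) Ah s c by (auto simp: \<beta>_def scalar_prod_def entries(2) atLeast0LessThan intro!: sum.cong)
        then show ?thesis unfolding inverse(1) using s c by auto
      qed
      have ars: "A $$ (i, 0) = 0" if "i < s" for i
        using entries(1,3) \<open>ARS_property s \<alpha>h \<beta>h\<close> that by (cases i) (auto simp: ARS_property_def)
      have lower: "A $$ (i, j) = 0" if "i < s" "j < s" "i < j" for i j
        using tableau that by (auto simp: dirk_imex_tableau_def)
      have "O_Ck L m 1 (\<lambda>\<epsilon> x. v_of (Q \<epsilon> (n - 1) (s - 1)) x
          - - (\<Sum>r<s - 1. \<beta> r * ((deriv (E (n - 1) (Suc r)) x - deriv (\<eta> (n - 1)) x) / dt)))"
      proof (rule imex_bbmh_family.step_convergence_ARS[OF family[OF l(1)] s])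
        show "imex_bbmh_family.start L (\<lambda>\<epsilon>. u_of (q \<epsilon> (n - 1))) (\<lambda>\<epsilon>. v_of (q \<epsilon> (n - 1)))
            (\<lambda>\<epsilon>. w_of (q \<epsilon> (n - 1))) (\<eta> (n - 1)) (m + 1 + 6 * s)"
          unfolding imex_bbmh_family.start_def[OF family[OF l(1)]] using start_last unfolding start_def .
      qed (fact Ck_le[OF C\<eta>[OF less_imp_le[OF l(1)]] le] Ck_le[OF CE[OF l(1)] le] lower ars \<beta>)+
      moreover have "\<forall>\<^sub>F \<epsilon> in at_right 0. \<forall>x. v_of (q \<epsilon> n) x
          - - discrete_dt s Ah dt (deriv (\<eta> (n - 1))) (\<lambda>i. deriv (E (n - 1) i)) x =
          v_of (Q \<epsilon> (n - 1) (s - 1)) x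
          - - (\<Sum>r<s - 1. \<beta> r * ((deriv (E (n - 1) (Suc r)) x - deriv (\<eta> (n - 1)) x) / dt))"
        using last[OF l(1)] unfolding l(2) D by eventually_elim simp
      ultimately show "O_Ck L m 1 (\<lambda>\<epsilon> x. v_of (q \<epsilon> n) x
          - - discrete_dt s Ah dt (deriv (\<eta> (n - 1))) (\<lambda>i. deriv (E (n - 1) i)) x)"
        by (simp only: O_Ck_cong)
      \<comment> \<open>\<open>Cm_limit\<close> also demands that the limit be C^m, which is evident
        for a finite combination of BBM stages.\<close>
      have "(\<lambda>x. - discrete_dt s Ah dt (deriv (\<eta> (n - 1))) (\<lambda>i. deriv (E (n - 1) i)) x) =
          (\<lambda>x. \<Sum>r<s - 1. (- \<beta> r / dt) * (deriv (E (n - 1) (Suc r)) x - deriv (\<eta> (n - 1)) x))"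
        unfolding D by (simp add: sum_negf)
      moreover have "Ck_periodic L m (\<lambda>x. \<Sum>r<s - 1. (- \<beta> r / dt) * (deriv (E (n - 1) (Suc r)) x - deriv (\<eta> (n - 1)) x))"
        using l by (intro Ck_sum Ck_cmult Ck_diff dC C\<eta> CE L) auto
      ultimately show "Ck_periodic L m (\<lambda>x. - discrete_dt s Ah dt (deriv (\<eta> (n - 1))) (\<lambda>i. deriv (E (n - 1) i)) x)"
        by simp
    qed
    show "Cm_limit L m (\<lambda>\<epsilon>. u_of (q \<epsilon> n)) (\<eta> n) \<and> Cm_limit L m (\<lambda>\<epsilon>. w_of (q \<epsilon> n)) (deriv (\<eta> n)) \<and>
       (ARS_property s \<alpha>h \<beta>h \<longrightarrow>
          Cm_limit L m (\<lambda>\<epsilon>. v_of (q \<epsilon> n))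
            (\<lambda>x. - discrete_dt s Ah dt (deriv (\<eta> (n - 1))) (\<lambda>i. deriv (E (n - 1) i)) x))"
      using u v w by blast
  qed
qed

end
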